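(* Let $\pi$ and $w$ be two permutations in the same Knuth equivalence class. (1) If $\pi$ and $w$ are related by a sequence of Knuth moves containing an odd number of $K_B$ moves, then $\mathrm{SD}(\pi)\neq\mathrm{SD}(w)$. (2) If $\pi$ and $w$ are related by a sequence of non-$K_B$ Knuth moves, then the shape of $\mathrm{SD}(\pi)$ equals the shape of $\mathrm{SD}(w)$.
   Context: Knuth moves on $S_n$, with $x<y<z$: $\pi$ and $w$ differ by a Knuth relation of the first kind ($K_1$) if one is $\cdots yxz\cdots$ and the other is $\cdots yzx\cdots$ (same entries elsewhere); of the second kind ($K_2$) if one is $\cdots xzy\cdots$ and the other is $\cdots zxy\cdots$. They differ by a $K_B$ move (both kinds) if one is $\cdots y_1xzy_2\cdots$ and the other is $\cdots y_1zxy_2\cdots$ with $x<y_1<z$ and $x<y_2<z$. A non-$K_B$ move is a $K_1$ or $K_2$ move which is not a $K_B$ move. Knuth equivalence is the equivalence relation generated by these moves. Box-ball system (BBS): boxes in a row extending infinitely to the right, each holding at most one ball, balls labeled $1,\dots,n$. A permutation $w=w_1\cdots w_n$ gives the time-$0$ configuration with ball $w_i$ in the $i$-th of $n$ consecutive boxes. A BBS move moves ball $1$ to the nearest empty box to its right, then ball $2$, ..., then ball $n$. An increasing run is a maximal block of balls in consecutive boxes with labels increasing left to right; a soliton is an increasing run preserved by all subsequent BBS moves. After finitely many moves the system reaches a steady state in which all increasing runs are solitons with lengths weakly decreasing from right to left. $\mathrm{SD}(w)$ is the tableau whose $i$-th row (from the top) is the $i$-th soliton from the right in a steady-state configuration of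 the system started at $w$. *)

theory Defs
  imports "HOL-Combinatorics.Multiset_Permutations"
begin

text \<open>A permutation in \<open>S\<^sub>n\<close> is given by its one-line notation, a list in
  \<^term>\<open>permutations_of_set {1..n}\<close>.\<close>

definition knuth1 :: "nat list \<Rightarrow> nat list \<Rightarrow> bool" where
  "knuth1 u v \<longleftrightarrow> (\<exists>as bs x y z. x < y \<and> y < z \<and>
     (u = as @ [y, x, z] @ bs \<and> v = as @ [y, z, x] @ bs \<or>
      v = as @ [y, x, z] @ bs \<and> u = as @ [y, z, x] @ bs))"

definition knuth2 :: "nat list \<Rightarrow> nat list \<Rightarrow> bool" where
  "knuth2 u v \<longleftrightarrow> (\<exists>as bs x y z. x < y \<and> y < z \<and>
     (u = as @ [x, z, y] @ bs \<and> v = as @ [z, x, y] @ bs \<or>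
      v = as @ [x, z, y] @ bs \<and> u = as @ [z, x, y] @ bs))"

definition knuthB :: "nat list \<Rightarrow> nat list \<Rightarrow> bool" where
  "knuthB u v \<longleftrightarrow> (\<exists>as bs x y1 y2 z. x < y1 \<and> y1 < z \<and> x < y2 \<and> y2 < z \<and>
     (u = as @ [y1, x, z, y2] @ bs \<and> v = as @ [y1, z, x, y2] @ bs \<or>
      v = as @ [y1, x, z, y2] @ bs \<and> u = as @ [y1, z, x, y2] @ bs))"

text \<open>Every \<open>K\<^sub>B\<close> move is both a \<open>K\<^sub>1\<close> and a \<open>K\<^sub>2\<close> move, so the disjunction
  below covers all three kinds.\<close>

definition knuth_move :: "nat list \<Rightarrow> nat list \<Rightarrow> bool" where
  "knuth_move u v \<longleftrightarrow> knuth1 u v \<or> knuth2 u v"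

definition non_KB_move :: "nat list \<Rightarrow> nat list \<Rightarrow> bool" where
  "non_KB_move u v \<longleftrightarrow> knuth_move u v \<and> \<not> knuthB u v"

definition knuth_equivalent :: "nat list \<Rightarrow> nat list \<Rightarrow> bool" where
  "knuth_equivalent = equivclp knuth_move"

text \<open>A sequence of moves is recorded by the list of permutations it visits, both end
  points included; the \<open>i\<close>-th move goes from \<open>ps ! i\<close> to \<open>ps ! Suc i\<close>.\<close>

definition move_sequence ::
    "(nat list \<Rightarrow> nat list \<Rightarrow> bool) \<Rightarrow> nat list list \<Rightarrow> nat list \<Rightarrow> nat list \<Rightarrow> bool" where
  "move_sequence R ps u v \<longleftrightarrow> ps \<noteq> [] \<and> hd ps = u \<and> last ps = v \<and>
     (\<forall>i. Suc i < length ps \<longrightarrow> R (ps ! i) (ps ! Suc i))"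

definition count_KB_moves :: "nat list list \<Rightarrow> nat" where
  "count_KB_moves ps = card {i. Suc i < length ps \<and> knuthB (ps ! i) (ps ! Suc i)}"

text \<open>A configuration maps each box, numbered from the left starting with 0, to the label of
  the ball it holds, or to \<^term>\<open>None\<close> if it is empty.\<close>

type_synonym configuration = "nat \<Rightarrow> nat option"

definition initial_configuration :: "nat list \<Rightarrow> configuration" where
  "initial_configuration w = (\<lambda>p. if p < length w then Some (w ! p) else None)"

definition move_ball :: "nat \<Rightarrow> configuration \<Rightarrow> configuration" where
  "move_ball b c =
     (let p = (THE p. c p = Some b);
          q = (LEAST q. p < q \<and> c q = None)
      in c(p := None, q := Some b))"

text \<open>One BBS move moves every ball \<open>1, \<dots>, n\<close> once, in this order; a box vacated by a
  smaller ball is available to a larger one.\<close>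

definition BBS_move :: "nat \<Rightarrow> configuration \<Rightarrow> configuration" where
  "BBS_move n c = fold move_ball [1..<Suc n] c"

definition BBS_state :: "nat list \<Rightarrow> nat \<Rightarrow> configuration" where
  "BBS_state w t = (BBS_move (length w) ^^ t) (initial_configuration w)"

text \<open>\<open>r\<close> lists the labels, from left to right, of the block whose leftmost box is \<open>p\<close>.\<close>

definition increasing_block :: "configuration \<Rightarrow> nat \<Rightarrow> nat list \<Rightarrow> bool" where
  "increasing_block c p r \<longleftrightarrow>
     r \<noteq> [] \<and> (\<forall>k < length r. c (p + k) = Some (r ! k)) \<and> sorted_wrt (<) r"

definition increasing_run :: "configuration \<Rightarrow> nat \<Rightarrow> nat list \<Rightarrow> bool" where
  "increasing_run c p r \<longleftrightarrow> increasing_block c p r \<and>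
     (\<forall>p' r'. increasing_block c p' r' \<and> {p..<p + length r} \<subseteq> {p'..<p' + length r'}
        \<longrightarrow> p' = p \<and> r' = r)"

definition soliton :: "nat \<Rightarrow> configuration \<Rightarrow> nat list \<Rightarrow> bool" where
  "soliton n c r \<longleftrightarrow> (\<forall>t. \<exists>p. increasing_run ((BBS_move n ^^ t) c) p r)"

definition runs_from_right :: "configuration \<Rightarrow> nat list list" where
  "runs_from_right c = map (\<lambda>p. THE r. increasing_run c p r)
     (rev (sorted_list_of_set {p. \<exists>r. increasing_run c p r}))"

definition steady_state :: "nat \<Rightarrow> configuration \<Rightarrow> bool" where
  "steady_state n c \<longleftrightarrow> (\<forall>p r. increasing_run c p r \<longrightarrow> soliton n c r) \<and>
     sorted_wrt (\<ge>) (map length (runs_from_right c))"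

text \<open>A tableau is the list of its rows, from top to bottom. The first steady state is used;
  the soliton decomposition is the same for every later time.\<close>

definition SD :: "nat list \<Rightarrow> nat list list" where
  "SD w = runs_from_right (BBS_state w (LEAST t. steady_state (length w) (BBS_state w t)))"

definition tableau_shape :: "nat list list \<Rightarrow> nat list" where
  "tableau_shape T = map length T"

end

theory Submission
  imports Defs "HOL-Library.Extended_Nat"
begin

text \<open>Read a configuration from left to right, an empty box counting as \<open>\<infinity>\<close>, and let \<open>D\<^sub>k\<close> be
  the largest total number of descents obtained by distributing the letters over \<open>k\<close>
  subsequences, each of them preceded by \<open>\<infinity>\<close>. Moving the smallest ball to the next empty box
  and declaring it to be the largest ball preserves \<open>D\<^sub>k\<close>; after all balls have moved the
  original order is restored, so \<open>D\<^sub>k\<close> is invariant under BBS moves. For \<open>k = 1\<close> it counts the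
  increasing runs, and it counts the first \<open>k\<close> columns of the soliton decomposition once the
  solitons move freely. A non-\<open>K\<^sub>B\<close> move preserves every \<open>D\<^sub>k\<close> of the initial word, because an
  exchange of tails between two subsequences makes up for any loss, whereas a \<open>K\<^sub>B\<close> move changes
  the number of descents by one.

  For the existence of the steady state: the set of balls of the rightmost run never shrinks, and
  once it is constant the remaining balls move as if that run were absent, so induction on the
  number of balls applies.\<close>

section \<open>Descents of words distributed over several subsequences\<close>

text \<open>\<open>D\<^sub>k\<close> plays the role that Greene's invariants play for Knuth
  equivalence, with descents along arbitrary subsequences counted in place of the letters of
  decreasing ones. What has been read matters only through the multiset of last letters, so the
  recursion runs over that state and every exchange of letters is checked locally: a comparison of
  two suffixes in all states extends to any common prefix. The tableau is read at the first steady
  time, where the spacing used to evaluate \<open>D\<^sub>k\<close> for \<open>k > 1\<close> is not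
  known to hold, whereas \<open>D\<^sub>1\<close> counts the runs of any configuration. The rows are
  therefore compared with the runs at a later time of free motion: solitons persist, and the equal
  number of runs forces the two sets of runs to agree. Since \<open>SD\<close> takes a
  \<open>LEAST\<close> over steady times, the existence of a steady state has to be proved. That
  induction deletes the rightmost run and leaves labels with gaps, so a BBS move is studied as
  \<open>fold move_ball bs\<close> for any strictly increasing list \<open>bs\<close>.\<close>

text \<open>The elements of \<open>M\<close> are the current last letters of the subsequences. The value is junk
  when \<open>M\<close> is empty.\<close>

fun max_des :: "'a::linorder multiset \<Rightarrow> 'a list \<Rightarrow> nat" where
  "max_des M [] = 0"
| "max_des M (x # xs) =
     Max ((\<lambda>a. of_bool (x < a) + max_des (add_mset x (M - {#a#})) xs) ` set_mset M)"

lemma max_des_ge: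
  "of_bool (x < a) + max_des (add_mset x M) xs \<le> max_des (add_mset a M) (x # xs)"
  by (auto intro!: Max_ge)

declare max_des.simps(2) [simp del]

lemma max_des_attained:
  assumes "M \<noteq> {#}"
  obtains a N where "M = add_mset a N"
    "max_des M (x # xs) = of_bool (x < a) + max_des (add_mset x N) xs"
proof -
  let ?f = "\<lambda>a. of_bool (x < a) + max_des (add_mset x (M - {#a#})) xs"
  have "Max (?f ` set_mset M) \<in> ?f ` set_mset M"
    using assms by (intro Max_in) auto
  then obtain a where "a \<in># M" "max_des M (x # xs) = ?f a"
    by (auto simp: max_des.simps(2))
  then show ?thesis using that[of a "M - {#a#}"] by simp
qed

lemma max_des_add_cases:
  obtains (top) "max_des (add_mset b M) (x # xs) = of_bool (x < b) + max_des (add_mset x M) xs"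
  | (rest) a N where "M = add_mset a N"
    "max_des (add_mset b M) (x # xs) = of_bool (x < a) + max_des (add_mset x (add_mset b N)) xs"
proof -
  obtain a N where a: "add_mset b M = add_mset a N"
    "max_des (add_mset b M) (x # xs) = of_bool (x < a) + max_des (add_mset x N) xs"
    using max_des_attained[of "add_mset b M" x xs] by auto
  from a(1) consider "b = a" "M = N" | K where "M = add_mset a K" "N = add_mset b K"
    by (auto simp: add_eq_conv_ex)
  then show ?thesis using a(2) that by cases auto
qed

lemma max_des_mono: "a \<le> b \<Longrightarrow> max_des (add_mset a M) xs \<le> max_des (add_mset b M) xs"
proof (induction xs arbitrary: M)
  case (Cons x xs)
  show ?case
  proof (cases rule: max_des_add_cases[of a M x xs])
    case top
    then show ?thesis using max_des_ge[of x b M xs] Cons.prems by (auto simp: of_bool_def split: if_splits)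
  next
    case (rest c N)
    then show ?thesis
      using max_des_ge[of x c "add_mset b N" xs] Cons.IH[OF Cons.prems, of "add_mset x N"]
      by (simp add: add_mset_commute)
  qed
qed simp

text \<open>All choices are kept. Nothing changes until some letter follows the altered last letter,
  and afterwards the states agree, so at most that one descent is lost.\<close>

lemma max_des_lipschitz: "max_des (add_mset b M) xs \<le> Suc (max_des (add_mset a M) xs)"
proof (induction xs arbitrary: M)
  case (Cons x xs)
  show ?case
  proof (cases rule: max_des_add_cases[of b M x xs])
    case top
    then show ?thesis using max_des_ge[of x a M xs]
      by (auto simp: of_bool_def split: if_splits)
  next
    case (rest c N)
    then show ?thesis
      using max_des_ge[of x c "add_mset a N" xs] Cons.IH[of "add_mset x N"]
      by (simp add: add_mset_commute)
  qed
qed simp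

text \<open>Let \<open>x\<close> follow any last letter \<open>a\<close>: if \<open>x < a\<close>,
  the new descent pays for the loss bounded by \<open>max_des_lipschitz\<close>; otherwise the last
  letter only grows.\<close>

lemma max_des_skip:
  assumes "M \<noteq> {#}"
  shows "max_des M xs \<le> max_des M (x # xs)"
proof -
  obtain a N where M: "M = add_mset a N" using assms by (meson multiset_cases)
  show ?thesis
    using max_des_ge[of x a N xs] max_des_lipschitz[of a N xs x] max_des_mono[of a x N xs]
    by (cases "x < a") (auto simp: M not_less)
qed

lemma max_des_skip_append: "M \<noteq> {#} \<Longrightarrow> max_des M ys \<le> max_des M (xs @ ys)"
  by (induction xs) (auto intro: order_trans[OF _ max_des_skip])

text \<open>The suffixes need to be compared only in states that can arise, whose last letters come
  from \<open>M\<close> or from the prefix. \<open>max_des_le_top\<close> depends on this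
  restriction.\<close>

lemma max_des_prefix:
  assumes "M \<noteq> {#}"
    and "\<And>N. N \<noteq> {#} \<Longrightarrow> set_mset N \<subseteq> set_mset M \<union> set as \<Longrightarrow> max_des N xs \<le> max_des N ys + d"
  shows "max_des M (as @ xs) \<le> max_des M (as @ ys) + d"
  using assms
proof (induction as arbitrary: M)
  case (Cons x as)
  obtain a N where a: "M = add_mset a N"
    "max_des M (x # as @ xs) = of_bool (x < a) + max_des (add_mset x N) (as @ xs)"
    using max_des_attained[OF Cons.prems(1)] .
  have "max_des (add_mset x N) (as @ xs) \<le> max_des (add_mset x N) (as @ ys) + d"
    by (rule Cons.IH) (auto intro!: Cons.prems(2) simp: a(1))
  then show ?case using max_des_ge[of x a N "as @ ys"] a
    by auto
qed auto

lemma max_des_prefix_eq: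
  assumes "M \<noteq> {#}"
    and "\<And>N. N \<noteq> {#} \<Longrightarrow> set_mset N \<subseteq> set_mset M \<union> set as \<Longrightarrow> max_des N xs = max_des N ys"
  shows "max_des M (as @ xs) = max_des M (as @ ys)"
  using max_des_prefix[of M as xs ys 0] max_des_prefix[of M as ys xs 0] assms
  by (intro antisym) auto

lemma max_des_image:
  assumes "strict_mono_on (set_mset M \<union> set xs) f"
  shows "max_des (image_mset f M) (map f xs) = max_des M xs"
  using assms
proof (induction xs arbitrary: M)
  case (Cons x xs)
  have "max_des (add_mset (f x) (image_mset f M - {#f a#})) (map f xs)
      = max_des (add_mset x (M - {#a#})) xs" if a: "a \<in># M" for a
  proof -
    have "strict_mono_on (set_mset (add_mset x (M - {#a#})) \<union> set xs) f"
      using Cons.prems by (rule monotone_on_subset) (auto dest: in_diffD)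
    from Cons.IH[OF this] show ?thesis using a by (simp add: image_mset_Diff)
  qed
  moreover have "f x < f a \<longleftrightarrow> x < a" if "a \<in># M" for a
    using that Cons.prems by (intro strict_mono_on_less[of "set_mset M \<union> set (x # xs)"]) auto
  ultimately show ?case by (simp add: max_des.simps(2) image_image cong: image_cong)
qed simp

lemma max_des_append_top:
  fixes xs :: "'a::{linorder,order_top} list"
  shows "M \<noteq> {#} \<Longrightarrow> max_des M (xs @ replicate j top) = max_des M xs"
proof (induction xs arbitrary: M)
  case Nil
  then show ?case
  proof (induction j arbitrary: M)
    case (Suc j)
    then obtain a N where "M = add_mset a N"
      "max_des M (top # replicate j top) = of_bool (top < a) + max_des (add_mset top N) (replicate j top)"
      using max_des_attained[OF Suc.prems] by blast
    then show ?case using Suc.IH[of "add_mset top N"] by simp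
  qed simp
next
  case (Cons x xs)
  then show ?case by (auto simp: max_des.simps(2) intro!: arg_cong[of _ _ Max] image_cong)
qed

lemma max_des_top_Cons:
  "max_des (replicate_mset (Suc k) top) (top # xs)
    = max_des (replicate_mset (Suc k) (top::'a::{linorder,order_top})) xs"
  by (simp add: max_des.simps(2))

lemma max_des_le_replicate_top:
  "max_des (M :: 'a::{linorder,order_top} multiset) xs \<le> max_des (replicate_mset (size M) top) xs"
proof -
  have "max_des (M + N) xs \<le> max_des (replicate_mset (size M) top + N) xs" for N :: "'a multiset"
  proof (induction M arbitrary: N)
    case (add x M)
    show ?case
      using max_des_mono[of x top "M + N" xs] add.IH[of "add_mset top N"] by simp
  qed simp
  from this[of "{#}"] show ?thesis by simp
qed

text \<open>At the cut between the two words, all last letters may be raised to infinity.\<close>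

lemma max_des_append_le:
  "M \<noteq> {#} \<Longrightarrow> max_des M (xs @ ys) \<le> max_des M xs
     + max_des (replicate_mset (size M) (top::'a::{linorder,order_top})) ys"
proof (induction xs arbitrary: M)
  case Nil
  then show ?case by (simp add: max_des_le_replicate_top)
next
  case (Cons x xs)
  obtain a N where a: "M = add_mset a N"
    "max_des M (x # xs @ ys) = of_bool (x < a) + max_des (add_mset x N) (xs @ ys)"
    using max_des_attained[OF Cons.prems(1)] .
  show ?case
    using Cons.IH[of "add_mset x N"] max_des_ge[of x a N xs] a by simp
qed

text \<open>A subsequence that has received a letter of the increasing word ends below all later
  letters and never descends again. Hence each last letter of \<open>M\<close> is used for at most
  one descent, and only if it exceeds the first letter.\<close>

lemma max_des_increasing_le:
  "sorted_wrt (<) (x # xs) \<Longrightarrow> M \<noteq> {#} \<Longrightarrow> max_des M (x # xs) \<le> size {#a \<in># M. x < a#}"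
proof (induction xs arbitrary: x M)
  case Nil
  obtain a N where a: "M = add_mset a N"
    "max_des M [x] = of_bool (x < a) + max_des (add_mset x N) []"
    using max_des_attained[OF Nil.prems(2)] .
  then show ?case by simp
next
  case (Cons y ys)
  obtain a N where a: "M = add_mset a N"
    "max_des M (x # y # ys) = of_bool (x < a) + max_des (add_mset x N) (y # ys)"
    using max_des_attained[OF Cons.prems(2)] .
  have "max_des (add_mset x N) (y # ys) \<le> size {#a \<in># add_mset x N. y < a#}"
    using Cons.prems by (intro Cons.IH) auto
  also have "\<dots> \<le> size {#a \<in># N. x < a#}"
  proof -
    have "x < y" using Cons.prems(1) by simp
    then have "{#a \<in># add_mset x N. y < a#} \<subseteq># {#a \<in># N. x < a#}"
      by (auto intro: filter_mset_mono_strong)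
    then show ?thesis by (rule size_mset_mono)
  qed
  finally show ?case using a by simp
qed

lemma max_des_le_length: "M \<noteq> {#} \<Longrightarrow> max_des M xs \<le> length xs"
proof (induction xs arbitrary: M)
  case (Cons x xs)
  obtain a N where a: "M = add_mset a N"
    "max_des M (x # xs) = of_bool (x < a) + max_des (add_mset x N) xs"
    using max_des_attained[OF Cons.prems(1)] .
  then show ?case using Cons.IH[of "add_mset x N"] by auto
qed simp

lemma max_des_increasing:
  assumes "sorted_wrt (<) xs" "M \<noteq> {#}"
  shows "max_des M xs \<le> min (size M) (length xs)"
proof (cases xs)
  case (Cons x ys)
  then have "max_des M xs \<le> size {#a \<in># M. x < a#}"
    using assms max_des_increasing_le by blast
  also have "\<dots> \<le> size M" by (simp add: size_mset_mono)
  finally show ?thesis using max_des_le_length[OF assms(2)] by simp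
qed simp

text \<open>The letter \<open>r ! i\<close> is made to follow \<open>L ! i\<close>, and letters of
  \<open>r\<close> beyond the length of \<open>L\<close> are skipped. In the induction
  \<open>N\<close> collects the letters already placed.\<close>

lemma max_des_decrease:
  assumes "\<And>i. i < length L \<Longrightarrow> i < length r \<Longrightarrow> r ! i < L ! i" "N + mset L \<noteq> {#}"
  shows "min (length L) (length r)
     + max_des (N + mset (take (length L) r) + mset (drop (length r) L)) ys
     \<le> max_des (N + mset L) (r @ ys)"
  using assms
proof (induction r arbitrary: L N)
  case (Cons x r)
  show ?case
  proof (cases L)
    case Nil
    then show ?thesis using max_des_skip_append[of N ys "x # r"] Cons.prems by simp
  next
    case [simp]: (Cons l L')
    have "x < l" using Cons.prems(1)[of 0] by simp
    then have "Suc (max_des (add_mset x N + mset L') (r @ ys)) \<le> max_des (N + mset L) (x # r @ ys)"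
      using max_des_ge[of x l "N + mset L'" "r @ ys"] by simp
    moreover have "min (length L') (length r)
     + max_des (add_mset x N + mset (take (length L') r) + mset (drop (length r) L')) ys
     \<le> max_des (add_mset x N + mset L') (r @ ys)"
    proof (rule Cons.IH)
      show "r ! i < L' ! i" if "i < length L'" "i < length r" for i
        using Cons.prems(1)[of "Suc i"] that by simp
    qed simp
    ultimately show ?thesis by simp
  qed
qed simp

section \<open>Exchange of adjacent letters\<close>

text \<open>Letters of different subsequences can be read in either order, so the critical case is
  \<open>z\<close> following \<open>x\<close>. Reading \<open>z\<close> first then gains the descent
  from \<open>z\<close> to \<open>x\<close>, and since \<open>b\<close> is outside the interval, it
  compares alike with \<open>x\<close> and \<open>z\<close>.\<close>

lemma max_des_swap1:
  assumes "x < z" "b < x \<or> z < b" "M \<noteq> {#}"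
  shows "max_des M (x # z # b # r) \<le> max_des M (z # x # b # r)"
proof -
  obtain a N where a: "M = add_mset a N"
    "max_des M (x # z # b # r) = of_bool (x < a) + max_des (add_mset x N) (z # b # r)"
    using max_des_attained[OF assms(3)] .
  show ?thesis
  proof (cases rule: max_des_add_cases[of x N z "b # r"])
    case A: top
    show ?thesis
    proof (cases rule: max_des_add_cases[of z N b r])
      case top
      then show ?thesis using A a assms(1,2)
        max_des_ge[of z a N "x # b # r"] max_des_ge[of x z N "b # r"] max_des_ge[of b x N r]
        by (auto simp: of_bool_def split: if_splits)
    next
      \<comment> \<open>Exchange of tails: \<open>z\<close> goes behind \<open>p\<close> and
        \<open>b\<close> behind \<open>x\<close>, which leaves the same last letters. A descent from
        \<open>p\<close> to \<open>b\<close> survives as one from \<open>p\<close> to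
        \<open>z\<close> if \<open>z < b\<close>, or is replaced by one from \<open>x\<close> to
        \<open>b\<close> if \<open>b < x\<close>.\<close>
      case (rest p N')
      then show ?thesis using A a assms(1,2)
        max_des_ge[of z p "add_mset a N'" "x # b # r"] max_des_ge[of x a "add_mset z N'" "b # r"]
        max_des_ge[of b x "add_mset z N'" r]
        by (auto simp: add_mset_commute of_bool_def split: if_splits)
    qed
  next
    case (rest d N')
    then show ?thesis using a assms(1,2)
        max_des_ge[of z d "add_mset a N'" "x # b # r"] max_des_ge[of x a "add_mset z N'" "b # r"]
        by (auto simp: add_mset_commute of_bool_def split: if_splits)
  qed
qed

text \<open>Critical is \<open>x\<close> following \<open>z\<close>. The descent from
  \<open>z\<close> to \<open>x\<close> is replaced by one from \<open>y\<close> to \<open>x\<close>,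
  and the resulting last letters are at least as large, so \<open>max_des_mono\<close>
  applies.\<close>

lemma max_des_swap2:
  assumes "x < y" "y < z"
  shows "max_des (add_mset y N) (z # x # r) \<le> max_des (add_mset y N) (x # z # r)"
proof (cases rule: max_des_add_cases[of y N z "x # r"])
  case A: top
  show ?thesis
  proof (cases rule: max_des_add_cases[of z N x r])
    case top
    then show ?thesis using A assms
        max_des_ge[of x y N "z # r"] max_des_ge[of z x N r] max_des_mono[OF less_imp_le, of x z N r] less_trans[OF assms]
        by (auto simp: of_bool_def split: if_splits)
  next
    case (rest d N')
    then show ?thesis using A assms
        max_des_ge[of x d "add_mset y N'" "z # r"] max_des_ge[of z y "add_mset x N'" r]
        by (auto simp: add_mset_commute of_bool_def split: if_splits)
  qed
next
  case B: (rest d N')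
  show ?thesis
  proof (cases rule: max_des_add_cases[of z "add_mset y N'" x r])
    case top
    then show ?thesis using B assms
        max_des_ge[of x y "add_mset d N'" "z # r"] max_des_ge[of z d "add_mset x N'" r]
        max_des_mono[OF less_imp_le, of y z "add_mset x N'" r]
        by (auto simp: add_mset_commute of_bool_def split: if_splits)
  next
    case (rest e N'')
    then consider "e = y" "N'' = N'" | K where "N' = add_mset e K" "N'' = add_mset y K"
      by (auto simp: add_eq_conv_ex)
    then show ?thesis
    proof cases
      case 1
      then show ?thesis using B rest(2) assms
        max_des_ge[of x y "add_mset d N'" "z # r"] max_des_ge[of z d "add_mset x N'" r]
        by (auto simp: add_mset_commute of_bool_def split: if_splits)
    next
      case 2
      then show ?thesis using B rest(2) assms
        max_des_ge[of x e "add_mset y (add_mset d K)" "z # r"]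
        max_des_ge[of z d "add_mset x (add_mset y K)" r]
        by (auto simp: add_mset_commute of_bool_def split: if_splits)
    qed
  qed
qed

text \<open>The descent from \<open>z\<close> to \<open>x\<close> in the critical case is replaced
  by one from \<open>z\<close> to \<open>y\<close>, with \<open>y\<close> moved behind
  \<open>z\<close>.\<close>

lemma max_des_swap3:
  assumes "x < y" "y < z" "M \<noteq> {#}"
  shows "max_des M (z # x # y # r) \<le> max_des M (x # z # y # r)"
proof -
  obtain a N where a: "M = add_mset a N"
    "max_des M (z # x # y # r) = of_bool (z < a) + max_des (add_mset z N) (x # y # r)"
    using max_des_attained[OF assms(3)] .
  show ?thesis
  proof (cases rule: max_des_add_cases[of z N x "y # r"])
    case A: top
    show ?thesis
    proof (cases rule: max_des_add_cases[of x N y r])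
      case top
      then show ?thesis using A a assms(1,2)
        max_des_ge[of x a N "z # y # r"] max_des_ge[of z x N "y # r"] max_des_ge[of y z N r]
        by (auto simp: of_bool_def split: if_splits)
    next
      case (rest p N')
      then show ?thesis using A a assms(1,2)
        max_des_ge[of x p "add_mset a N'" "z # y # r"] max_des_ge[of z a "add_mset x N'" "y # r"]
        max_des_ge[of y z "add_mset x N'" r]
        by (auto simp: add_mset_commute of_bool_def split: if_splits)
    qed
  next
    case (rest d N')
    then show ?thesis using a assms(1,2)
        max_des_ge[of x d "add_mset a N'" "z # y # r"] max_des_ge[of z a "add_mset x N'" "y # r"]
        by (auto simp: add_mset_commute of_bool_def split: if_splits)
  qed
qed

text \<open>Critical is \<open>z\<close> following \<open>x\<close>; now \<open>z\<close> is placed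
  behind \<open>a\<close> instead. Where the last letters become worse, a new descent, from
  \<open>z\<close> to \<open>x\<close> or from \<open>a\<close> to \<open>z\<close>, pays for it by
  \<open>max_des_lipschitz\<close>.\<close>

lemma max_des_swap4:
  assumes "x < z" "a < x \<or> z < a"
  shows "max_des (add_mset a N) (x # z # r) \<le> max_des (add_mset a N) (z # x # r)"
proof (cases rule: max_des_add_cases[of a N x "z # r"])
  case A: top
  show ?thesis
  proof (cases rule: max_des_add_cases[of x N z r])
    case top
    then show ?thesis using A assms
        max_des_ge[of z a N "x # r"] max_des_ge[of x z N r] max_des_lipschitz[of z N r x]
        by (auto simp: of_bool_def split: if_splits)
  next
    case (rest d N')
    then show ?thesis using A assms
        max_des_ge[of z d "add_mset a N'" "x # r"] max_des_ge[of x a "add_mset z N'" r]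
        by (auto simp: add_mset_commute of_bool_def split: if_splits)
  qed
next
  case B: (rest d N')
  show ?thesis
  proof (cases rule: max_des_add_cases[of x "add_mset a N'" z r])
    case top
    then show ?thesis using B assms
        max_des_ge[of z a "add_mset d N'" "x # r"] max_des_ge[of x d "add_mset z N'" r]
        max_des_mono[OF less_imp_le, of a x "add_mset z N'" r] max_des_lipschitz[of a "add_mset z N'" r x]
        by (auto simp: add_mset_commute of_bool_def split: if_splits)
  next
    case (rest e N'')
    then consider "e = a" "N'' = N'" | K where "N' = add_mset e K" "N'' = add_mset a K"
      by (auto simp: add_eq_conv_ex)
    then show ?thesis
    proof cases
      case 1
      then show ?thesis using B rest(2) assms
        max_des_ge[of z a "add_mset d N'" "x # r"] max_des_ge[of x d "add_mset z N'" r]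
        by (auto simp: add_mset_commute of_bool_def split: if_splits)
    next
      case 2
      then show ?thesis using B rest(2) assms
        max_des_ge[of z e "add_mset a (add_mset d K)" "x # r"]
        max_des_ge[of x d "add_mset z (add_mset a K)" r]
        by (auto simp: add_mset_commute of_bool_def split: if_splits)
    qed
  qed
qed

section \<open>Jump of the smallest letter\<close>

text \<open>A ball \<open>v\<close>, the smallest one, is swapped with the next empty box and gets the label
  \<open>v'\<close>, just below the value \<^term>\<open>top\<close> of the empty boxes.\<close>

context
  fixes v v' :: "'a::{linorder,order_top}" and C :: "'a list"
  assumes v: "v < v'" "v' < top"
    and C: "\<And>x. x \<in> set C \<Longrightarrow> x = top \<or> x < v'"
begin

text \<open>No letter of \<open>C\<close> lies in the interval from \<open>v'\<close> to infinity,
  infinity excluded, so the two last letters compare alike with all of \<open>C\<close>.\<close>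

lemma max_des_replace_top: "max_des (add_mset v' M) C = max_des (add_mset top M) C"
  using C
proof (induction C arbitrary: M)
  case (Cons x C)
  have IH: "max_des (add_mset v' N) C = max_des (add_mset top N) C" for N
    using Cons by auto
  have x: "x < v' \<longleftrightarrow> x < top" using Cons.prems[of x] v by (auto dest: less_trans)
  show ?case
  proof (rule antisym)
    show "max_des (add_mset v' M) (x # C) \<le> max_des (add_mset top M) (x # C)"
      using v by (intro max_des_mono) simp
    show "max_des (add_mset top M) (x # C) \<le> max_des (add_mset v' M) (x # C)"
    proof (cases rule: max_des_add_cases[of top M x C])
      case top
      then show ?thesis using max_des_ge[of x v' M C] x by simp
    next
      case (rest a N)
      then show ?thesis using max_des_ge[of x a "add_mset v' N" C] IH[of "add_mset x N"]
        by (simp add: add_mset_commute)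
    qed
  qed
qed simp

lemma max_des_top_le:
  "M \<noteq> {#} \<Longrightarrow> max_des M (B @ top # C) \<le> max_des M (B @ v' # C)"
proof -
  have "max_des N (top # C) \<le> max_des N (v' # C) + 0" if N: "N \<noteq> {#}" for N
  proof -
    obtain a N' where "N = add_mset a N'"
      "max_des N (top # C) = of_bool (top < a) + max_des (add_mset top N') C"
      using max_des_attained[OF N] .
    then show ?thesis using max_des_ge[of v' a N' C]
      by (simp add: max_des_replace_top)
  qed
  then show "M \<noteq> {#} \<Longrightarrow> ?thesis" using max_des_prefix[of M B "top # C" "v' # C" 0] by simp
qed

text \<open>The letter \<open>v'\<close> could descend only from a larger last letter, and in the
  states considered there is none.\<close>

lemma max_des_le_top:
  assumes "M \<noteq> {#}" "\<And>x. x \<in> set_mset M \<union> set B \<Longrightarrow> x \<le> v'"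
  shows "max_des M (B @ v' # C) \<le> max_des M (B @ top # C)"
proof -
  have "max_des N (v' # C) \<le> max_des N (top # C) + 0"
    if N: "N \<noteq> {#}" "set_mset N \<subseteq> set_mset M \<union> set B" for N
  proof -
    obtain a N' where a: "N = add_mset a N'"
      "max_des N (v' # C) = of_bool (v' < a) + max_des (add_mset v' N') C"
      using max_des_attained[OF N(1)] .
    have "\<not> v' < a" using assms(2)[of a] N(2) a(1) by auto
    then show ?thesis using max_des_ge[of top a N' C] a
      by (simp add: max_des_replace_top)
  qed
  then show ?thesis using max_des_prefix[of M B "v' # C" "top # C" 0] assms(1) by simp
qed

text \<open>A subsequence reset to infinity is worth one descent more than one ending in
  \<open>v\<close>, below all of \<open>B\<close>: the extra descent is taken by a letter of
  \<open>B\<close>, or at the latest by \<open>v'\<close>.\<close>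

lemma max_des_jump_aux:
  assumes "\<And>x. x \<in># M \<Longrightarrow> v < x \<and> (x = top \<or> x < v')"
    and "\<And>x. x \<in> set B \<Longrightarrow> v < x \<and> x < v'"
  shows "max_des (add_mset top M) (B @ v' # C) = Suc (max_des (add_mset v M) (B @ top # C))"
  using assms
proof (induction B arbitrary: M)
  case Nil
  show ?case
  proof (rule antisym)
    show "max_des (add_mset top M) ([] @ v' # C) \<le> Suc (max_des (add_mset v M) ([] @ top # C))"
    proof (cases rule: max_des_add_cases[of top M v' C])
      case top
      then show ?thesis using max_des_ge[of top v M C] v
        by (simp add: max_des_replace_top)
    next
      case (rest d N)
      have "v' < d \<Longrightarrow> d = top" using Nil.prems(1)[of d] rest(1) by auto
      then show ?thesis using max_des_ge[of top v M C] v rest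
          max_des_lipschitz[of top "add_mset top N" C d] max_des_replace_top[of "add_mset top N"]
        by (auto simp: max_des_replace_top add_mset_commute)
    qed
    show "Suc (max_des (add_mset v M) ([] @ top # C)) \<le> max_des (add_mset top M) ([] @ v' # C)"
    proof (cases rule: max_des_add_cases[of v M top C])
      case top
      then show ?thesis using max_des_ge[of v' top M C] v
        by (simp add: max_des_replace_top)
    next
      case (rest d N)
      have "v \<le> d" using Nil.prems(1)[of d] rest(1) by auto
      then show ?thesis using max_des_ge[of v' top M C] v rest
          max_des_mono[of v d "add_mset top N" C] max_des_replace_top[of "add_mset d N"]
        by (auto simp: max_des_replace_top add_mset_commute)
    qed
  qed
next
  case (Cons b B)
  have b: "v < b" "b < v'" "b < top"
    using Cons.prems(2)[of b] v by (auto intro: less_trans)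
  have IH: "max_des (add_mset top N) (B @ v' # C) = Suc (max_des (add_mset v N) (B @ top # C))"
    if "N = add_mset b K" "M = add_mset d K" for N d K
    by (rule Cons.IH) (use that Cons.prems b in auto)
  show ?case
  proof (rule antisym)
    have swap: "max_des (add_mset top M) ((b # B) @ v' # C)
        \<le> Suc (max_des (add_mset v M) ((b # B) @ top # C))"
      if "M = add_mset d N" "max_des (add_mset top M) ((b # B) @ v' # C)
         = of_bool (b < d) + max_des (add_mset b (add_mset top N)) (B @ v' # C)" for d N
      using that IH[OF refl, of d N] max_des_ge[of b d "add_mset v N" "B @ top # C"]
      by (auto simp: add_mset_commute)
    show "max_des (add_mset top M) ((b # B) @ v' # C) \<le> Suc (max_des (add_mset v M) ((b # B) @ top # C))"
    proof (cases rule: max_des_add_cases[of top M b "B @ v' # C"])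
      case eq: top
      show ?thesis
      proof (cases "top \<in># M")
        case True
        then obtain N where "M = add_mset top N" by (metis insert_DiffM)
        then show ?thesis using swap[of top N] eq by simp
      next
        \<comment> \<open>Without infinity among the last letters, \<open>v'\<close> makes no
          descent and can be turned into infinity. On the other side \<open>b\<close> is then placed
          behind \<open>v\<close>, without a descent.\<close>
        case False
        then have "x \<le> v'" if "x \<in># M" for x using Cons.prems(1)[OF that] that by auto
        then have "max_des (add_mset b M) (B @ v' # C) \<le> max_des (add_mset b M) (B @ top # C)"
          using Cons.prems(2) b by (intro max_des_le_top) (auto intro: less_imp_le)
        then show ?thesis using eq b max_des_ge[of b v M "B @ top # C"] by simp
      qed
    next
      case (rest d N)
      then show ?thesis using swap by simp
    qed
    show "Suc (max_des (add_mset v M) ((b # B) @ top # C)) \<le> max_des (add_mset top M) ((b # B) @ v' # C)"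
    proof (cases rule: max_des_add_cases[of v M b "B @ top # C"])
      case top
      then show ?thesis using b max_des_ge[of b top M "B @ v' # C"]
          max_des_top_le[of "add_mset b M" B] by auto
    next
      case (rest d N)
      then show ?thesis using IH[OF refl, of d N] max_des_ge[of b d "add_mset top N" "B @ v' # C"]
        by (auto simp: add_mset_commute)
    qed
  qed
qed

text \<open>Whichever last letter is chosen, \<open>v\<close> descends from it and infinity does
  not. By \<open>max_des_jump_aux\<close> the rest of the word returns exactly this one
  descent.\<close>

lemma max_des_jump:
  assumes "M \<noteq> {#}" "\<And>x. x \<in> set_mset M \<union> set A \<Longrightarrow> v < x \<and> (x = top \<or> x < v')"
    and "\<And>x. x \<in> set B \<Longrightarrow> v < x \<and> x < v'"
  shows "max_des M (A @ top # B @ v' # C) = max_des M (A @ v # B @ top # C)"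
proof (rule max_des_prefix_eq[OF assms(1)])
  fix N assume N: "N \<noteq> {#}" "set_mset N \<subseteq> set_mset M \<union> set A"
  have "max_des (add_mset top (N - {#a#})) (B @ v' # C)
      = Suc (max_des (add_mset v (N - {#a#})) (B @ top # C))" and "v < a" if "a \<in># N" for a
  proof -
    show "v < a" using assms(2)[of a] N(2) that by blast
    show "max_des (add_mset top (N - {#a#})) (B @ v' # C)
      = Suc (max_des (add_mset v (N - {#a#})) (B @ top # C))"
      using assms(2,3) N by (intro max_des_jump_aux) (meson in_diffD subsetD)+
  qed
  then show "max_des N (top # B @ v' # C) = max_des N (v # B @ top # C)"
    by (simp add: max_des.simps(2) cong: image_cong)
qed

end

section \<open>Knuth moves\<close>

lemma max_des_Cons_le:
  assumes "\<And>N. max_des (add_mset y N) xs \<le> max_des (add_mset y N) ys" "M \<noteq> {#}"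
  shows "max_des M (y # xs) \<le> max_des M (y # ys)"
proof -
  obtain a N where "M = add_mset a N"
    "max_des M (y # xs) = of_bool (y < a) + max_des (add_mset y N) xs"
    using max_des_attained[OF assms(2)] .
  then show ?thesis using assms(1)[of N] max_des_ge[of y a N ys] by simp
qed

definition word_des :: "nat \<Rightarrow> nat list \<Rightarrow> nat" where
  "word_des k u = max_des (replicate_mset k top) (map enat u)"

text \<open>The letter \<open>y\<close> in front of the exchanged pair gives one inequality by
  \<open>max_des_swap2\<close>, the letter behind the pair the other by
  \<open>max_des_swap1\<close>.\<close>

lemma word_des_K1:
  assumes "x < y" "y < z" "bs = [] \<or> hd bs < x \<or> z < hd bs" "k > 0"
  shows "word_des k (as @ [y, x, z] @ bs) = word_des k (as @ [y, z, x] @ bs)"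
proof -
  \<comment> \<open>An infinite letter appended to the word serves as \<open>b\<close> when
    \<open>bs\<close> is empty.\<close>
  obtain b r where br: "map enat bs @ replicate 1 top = b # r" "b < enat x \<or> enat z < b"
    using assms(3) by (cases bs) (auto simp: top_enat_def)
  have "max_des N (enat y # enat x # enat z # b # r) = max_des N (enat y # enat z # enat x # b # r)"
    if "N \<noteq> {#}" for N
    using assms br(2) that
    by (intro antisym max_des_Cons_le max_des_swap1 max_des_swap2) auto
  then have "max_des M (map enat as @ enat y # enat x # enat z # b # r)
      = max_des M (map enat as @ enat y # enat z # enat x # b # r)" if "M \<noteq> {#}" for M
    using that by (intro max_des_prefix_eq)
  moreover have "word_des k u = max_des (replicate_mset k top) (map enat u @ replicate 1 top)" for u
    unfolding word_des_def using assms(4) by (subst max_des_append_top) auto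
  ultimately show ?thesis using br(1) assms(4) by simp
qed

lemma word_des_K2:
  assumes "x < y" "y < z" "as = [] \<or> last as < x \<or> z < last as" "k > 0"
  shows "word_des k (as @ [x, z, y] @ bs) = word_des k (as @ [z, x, y] @ bs)"
proof -
  \<comment> \<open>At the start of the word the preceding letter is infinity, which can be put in
    front by \<open>max_des_top_Cons\<close>.\<close>
  obtain a r where ar: "top # map enat as = r @ [a]" "a < enat x \<or> enat z < a"
  proof (cases as rule: rev_exhaust)
    case Nil
    then show ?thesis using that[of "[]" top] by (simp add: top_enat_def)
  next
    case (snoc as' a)
    then show ?thesis using that[of "top # map enat as'" "enat a"] assms(3) by simp
  qed
  let ?bs = "map enat bs"
  have "max_des N (a # enat x # enat z # enat y # ?bs) = max_des N (a # enat z # enat x # enat y # ?bs)"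
    if "N \<noteq> {#}" for N
    using assms ar(2) that
    by (intro antisym max_des_Cons_le max_des_swap3 max_des_swap4) auto
  then have "max_des M (r @ a # enat x # enat z # enat y # ?bs)
      = max_des M (r @ a # enat z # enat x # enat y # ?bs)" if "M \<noteq> {#}" for M
    using that by (intro max_des_prefix_eq)
  moreover have "word_des k (as @ v) = max_des (replicate_mset k top) (r @ a # map enat v)" for v
  proof -
    have eq: "r @ a # map enat v = top # map enat (as @ v)" using ar(1) by (metis append_Cons append.assoc append_Nil map_append)
    then show ?thesis
      unfolding word_des_def using assms(4) max_des_top_Cons[of "k - 1" "map enat (as @ v)"]
      by (simp only: eq) simp
  qed
  ultimately show ?thesis using assms(4) by simp
qed

lemma max_des_singleton:
  "max_des {#a#} (x # xs) = of_bool (x < a) + max_des {#x#} xs"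
  by (simp add: max_des.simps(2))

text \<open>For \<open>k = 1\<close> there are no choices. Inside the four letters,
  \<open>y1 x z y2\<close> has two descents and \<open>y1 z x y2\<close> one; the outer letters
  agree, so the surroundings are unaffected. The odd sum expresses this for both directions of the
  move.\<close>

lemma knuthB_word_des:
  assumes "knuthB u v"
  shows "odd (word_des 1 u + word_des 1 v)"
proof -
  have "max_des {#a#} (map enat (as @ [y1, x, z, y2] @ bs))
      = Suc (max_des {#a#} (map enat (as @ [y1, z, x, y2] @ bs)))"
    if "x < y1" "y1 < z" "x < y2" "y2 < z" for as bs x y1 y2 z a
    using that by (induction as arbitrary: a) (auto simp: max_des_singleton)
  then show ?thesis using assms unfolding knuthB_def word_des_def by fastforce
qed

lemma knuthB_sym: "knuthB u v \<longleftrightarrow> knuthB v u"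
  unfolding knuthB_def by (simp only: disj_commute)

lemma knuth_move_mset: "knuth_move u v \<Longrightarrow> mset u = mset v"
  unfolding knuth_move_def knuth1_def knuth2_def by (elim disjE exE conjE) simp_all

text \<open>In a distinct word, a neighbour that violates the condition of
  \<open>word_des_K1\<close> or \<open>word_des_K2\<close> lies strictly between \<open>x\<close>
  and \<open>z\<close>, and then the move is a \<open>K\<^sub>B\<close> move.\<close>

lemma non_KB_move_word_des:
  assumes "non_KB_move u v" "distinct u" "k > 0"
  shows "word_des k u = word_des k v"
proof -
  have K1: "word_des k u = word_des k v"
    if *: "u = as @ [y, x, z] @ bs" "v = as @ [y, z, x] @ bs" "x < y" "y < z"
      and "\<not> knuthB u v" "distinct u" for u v as bs x y z
  proof -
    have "bs = [] \<or> hd bs < x \<or> z < hd bs"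
    proof (rule ccontr)
      assume A: "\<not> ?thesis"
      then obtain b r where b: "bs = b # r" by (cases bs) auto
      then have "x < b" "b < z" using A \<open>distinct u\<close> *(1) by auto
      then have "knuthB u v" unfolding knuthB_def using * b
        by (intro exI[of _ as] exI[of _ r] exI[of _ x] exI[of _ y] exI[of _ b] exI[of _ z]) auto
      then show False using that by simp
    qed
    then show ?thesis using word_des_K1[of x y z bs k as] * assms(3) by simp
  qed
  have K2: "word_des k u = word_des k v"
    if *: "u = as @ [x, z, y] @ bs" "v = as @ [z, x, y] @ bs" "x < y" "y < z"
      and "\<not> knuthB u v" "distinct u" for u v as bs x y z
  proof -
    have "as = [] \<or> last as < x \<or> z < last as"
    proof (rule ccontr)
      assume A: "\<not> ?thesis"
      then obtain a r where a: "as = r @ [a]" by (cases as rule: rev_exhaust) auto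
      then have "x < a" "a < z" using A \<open>distinct u\<close> *(1) by auto
      then have "knuthB u v" unfolding knuthB_def using * a
        by (intro exI[of _ r] exI[of _ bs] exI[of _ x] exI[of _ a] exI[of _ y] exI[of _ z]) auto
      then show False using that by simp
    qed
    then show ?thesis using word_des_K2[of x y z as k bs] * assms(3) by simp
  qed
  have nB: "\<not> knuthB u v" "\<not> knuthB v u" "distinct v"
    using assms knuthB_sym[of u v] knuth_move_mset[of u v] mset_eq_imp_distinct_iff[of u v] unfolding non_KB_move_def
    by simp_all
  have "knuth1 u v \<or> knuth2 u v"
    using assms unfolding non_KB_move_def knuth_move_def by blast
  then show ?thesis
  proof
    assume "knuth1 u v"
    then obtain as bs x y z where "x < y" "y < z"
      "u = as @ [y, x, z] @ bs \<and> v = as @ [y, z, x] @ bs \<or>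
       v = as @ [y, x, z] @ bs \<and> u = as @ [y, z, x] @ bs" unfolding knuth1_def by blast
    then show ?thesis
      using K1[of u as y x z bs v] K1[of v as y x z bs u] nB assms(2) by argo
  next
    assume "knuth2 u v"
    then obtain as bs x y z where "x < y" "y < z"
      "u = as @ [x, z, y] @ bs \<and> v = as @ [z, x, y] @ bs \<or>
       v = as @ [x, z, y] @ bs \<and> u = as @ [z, x, y] @ bs" unfolding knuth2_def by blast
    then show ?thesis
      using K2[of u as x z y bs v] K2[of v as x z y bs u] nB assms(2) by argo
  qed
qed

section \<open>Descents along sequences of Knuth moves\<close>

lemma move_sequence_Cons:
  "move_sequence R (p # q # ps) u v \<longleftrightarrow> p = u \<and> R p q \<and> move_sequence R (q # ps) q v"
proof -
  have "(\<forall>i. Suc i < length (p # q # ps) \<longrightarrow> R ((p # q # ps) ! i) ((p # q # ps) ! Suc i))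
    \<longleftrightarrow> R p q \<and> (\<forall>i. Suc i < length (q # ps) \<longrightarrow> R ((q # ps) ! i) ((q # ps) ! Suc i))"
    (is "?L \<longleftrightarrow> ?R")
  proof
    assume L: ?L
    then show ?R by (metis Suc_less_eq length_Cons nth_Cons_0 nth_Cons_Suc zero_less_Suc)
  next
    assume R: ?R
    show ?L
    proof (intro allI impI)
      fix i assume "Suc i < length (p # q # ps)"
      with R show "R ((p # q # ps) ! i) ((p # q # ps) ! Suc i)" by (cases i) auto
    qed
  qed
  then show ?thesis unfolding move_sequence_def by auto
qed

lemma count_KB_moves_Cons:
  "count_KB_moves (p # q # ps) = of_bool (knuthB p q) + count_KB_moves (q # ps)"
proof -
  let ?S = "{i. Suc i < length (q # ps) \<and> knuthB ((q # ps) ! i) ((q # ps) ! Suc i)}"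
  have "{i. Suc i < length (p # q # ps) \<and> knuthB ((p # q # ps) ! i) ((p # q # ps) ! Suc i)}
      = (if knuthB p q then {0} else {}) \<union> Suc ` ?S" (is "?L = ?R")
  proof (rule set_eqI)
    fix i show "i \<in> ?L \<longleftrightarrow> i \<in> ?R" by (cases i) auto
  qed
  moreover have "finite ?S" by (rule finite_subset[of _ "{..length (q # ps)}"]) auto
  ultimately show ?thesis unfolding count_KB_moves_def
    by (auto simp: card_image card_insert_if)
qed

lemma move_sequence_parity:
  "move_sequence knuth_move ps u v \<Longrightarrow> distinct u \<Longrightarrow>
     even (word_des 1 u + word_des 1 v + count_KB_moves ps)"
proof (induction ps arbitrary: u rule: induct_list012)
  case (2 p)
  then show ?case by (auto simp: move_sequence_def count_KB_moves_def)
next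
  case (3 p q ps)
  then have *: "p = u" "knuth_move u q" "move_sequence knuth_move (q # ps) q v"
    by (auto simp: move_sequence_Cons)
  then have "distinct q" using 3(4) knuth_move_mset mset_eq_imp_distinct_iff by blast
  then have IH: "even (word_des 1 q + word_des 1 v + count_KB_moves (q # ps))" using 3(2) * by blast
  show ?case
  proof (cases "knuthB u q")
    case True
    then show ?thesis using IH knuthB_word_des[OF True] * by (auto simp: count_KB_moves_Cons)
  next
    case False
    then have "word_des 1 u = word_des 1 q"
      using * 3(4) by (intro non_KB_move_word_des) (auto simp: non_KB_move_def)
    then show ?thesis using IH False * by (simp add: count_KB_moves_Cons)
  qed
qed (simp add: move_sequence_def)

lemma move_sequence_word_des:
  "move_sequence non_KB_move ps u v \<Longrightarrow> distinct u \<Longrightarrow> k > 0 \<Longrightarrow> word_des k u = word_des k v"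
proof (induction ps arbitrary: u rule: induct_list012)
  case (2 p)
  then show ?case by (auto simp: move_sequence_def)
next
  case (3 p q ps)
  then have *: "p = u" "non_KB_move u q" "move_sequence non_KB_move (q # ps) q v"
    by (auto simp: move_sequence_Cons)
  then have "distinct q" using 3(4) knuth_move_mset mset_eq_imp_distinct_iff
    unfolding non_KB_move_def by blast
  then show ?case using 3(2)[of q] * non_KB_move_word_des[of u q k] 3(4,5) by simp
qed (simp add: move_sequence_def)

section \<open>Conservation under BBS moves\<close>

text \<open>These conditions give meaning to the descriptions in \<open>move_ball\<close>: every
  label of \<open>S\<close> sits in exactly one box, and there is an empty box to the right of every
  ball.\<close>

definition valid :: "nat set \<Rightarrow> configuration \<Rightarrow> bool" where
  "valid S c \<longleftrightarrow> finite (dom c) \<and> ran c = S \<and> inj_on c (dom c)"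

lemma valid_unique: "valid S c \<Longrightarrow> c p = Some b \<Longrightarrow> c q = Some b \<Longrightarrow> p = q"
  unfolding valid_def by (auto intro: inj_onD[of c "dom c"])

lemma valid_label: "valid S c \<Longrightarrow> c p = Some b \<Longrightarrow> b \<in> S"
  unfolding valid_def ran_def by auto

lemma valid_move_ball:
  assumes "valid S c" "b \<in> S"
  obtains p q where "c p = Some b" "p < q" "c q = None" "\<And>j. p < j \<Longrightarrow> j < q \<Longrightarrow> c j \<noteq> None"
    "move_ball b c = c(p := None, q := Some b)" "valid S (move_ball b c)"
proof -
  obtain p where p: "c p = Some b" using assms by (auto simp: valid_def ran_def)
  have the: "(THE p. c p = Some b) = p"
    using p valid_unique[OF assms(1)] by blast
  define q where "q = (LEAST q. p < q \<and> c q = None)"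
  obtain N where "dom c \<subseteq> {..<N}"
    using assms(1) finite_nat_iff_bounded by (auto simp: valid_def)
  then have "p < Suc (max p N) \<and> c (Suc (max p N)) = None" by (force simp: dom_def)
  then have q: "p < q \<and> c q = None" unfolding q_def by (rule LeastI)
  have between: "c j \<noteq> None" if "p < j" "j < q" for j
    using not_less_Least[of j "\<lambda>q. p < q \<and> c q = None"] that unfolding q_def by auto
  have move: "move_ball b c = c(p := None, q := Some b)"
    unfolding move_ball_def the q_def by simp
  have dom: "dom (move_ball b c) = insert q (dom c - {p})" using q p by (auto simp: move)
  have "ran (move_ball b c) = S"
  proof -
    have "ran (move_ball b c) = insert b (ran (c(p := None)))"
      using q by (simp add: move ran_map_upd)
    also have "ran (c(p := None)) = ran c - {b}"
  proof (rule set_eqI)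
      fix x
      have "c a = Some b \<longleftrightarrow> a = p" for a using p valid_unique[OF assms(1), of a b p] by blast
      then have "(\<exists>a. (c(p := None)) a = Some x) \<longleftrightarrow> (\<exists>a. c a = Some x) \<and> x \<noteq> b"
        using p by (metis fun_upd_apply option.distinct(1) option.inject)
      then show "x \<in> ran (c(p := None)) \<longleftrightarrow> x \<in> ran c - {b}" by (simp add: ran_def)
    qed
    finally show ?thesis using assms by (auto simp: valid_def)
  qed
  moreover have "inj_on (move_ball b c) (dom (move_ball b c))"
  proof (rule inj_onI)
    fix x y assume *: "x \<in> dom (move_ball b c)" "move_ball b c x = move_ball b c y"
    then obtain a where "move_ball b c x = Some a" "move_ball b c y = Some a"
      by (metis domD)
    moreover have "c x = Some a" if "move_ball b c x = Some a" "x \<noteq> q" for x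
      using that by (simp add: move split: if_splits)
    moreover have "x \<noteq> p" if "move_ball b c x = Some a" for x
      using that q by (auto simp: move split: if_splits)
    moreover have "move_ball b c q = Some b" by (simp add: move)
    ultimately show "x = y" using valid_unique[OF assms(1)] p by (metis option.inject)
  qed
  ultimately have "valid S (move_ball b c)" using assms(1) by (simp add: valid_def dom)
  then show ?thesis using that p q between move by blast
qed

lemma valid_fold_move_ball:
  "valid S c \<Longrightarrow> set bs \<subseteq> S \<Longrightarrow> valid S (fold move_ball bs c)"
proof (induction bs arbitrary: c)
  case (Cons b bs)
  then show ?case by simp (metis valid_move_ball)
qed simp

lemma fold_move_ball_other:
  "valid S c \<Longrightarrow> set bs \<subseteq> S \<Longrightarrow> b \<notin> set bs \<Longrightarrow> c p = Some b \<Longrightarrow> fold move_ball bs c p = Some b"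
proof (induction bs arbitrary: c)
  case (Cons a bs)
  obtain p' q where "c p' = Some a" "c q = None"
    "move_ball a c = c(p' := None, q := Some a)" "valid S (move_ball a c)"
    using valid_move_ball[of S c a] Cons.prems by (metis list.set_intros(1) subsetD)
  then have "move_ball a c p = Some b" "valid S (move_ball a c)" using Cons.prems by auto
  then show ?case using Cons.IH Cons.prems by simp
qed simp

text \<open>The labels in \<open>S\<close> belong to the balls that have already moved.\<close>

definition box_key :: "nat \<Rightarrow> nat set \<Rightarrow> nat option \<Rightarrow> enat" where
  "box_key K S v = (case v of None \<Rightarrow> top | Some b \<Rightarrow> enat (if b \<in> S then b + K else b))"

text \<open>The least cut is only a canonical choice. By \<open>config_des_eq\<close> any later cut
  gives the same value for \<open>k > 0\<close>, which allows configurations of different extent to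
  be compared.\<close>

definition config_des :: "nat \<Rightarrow> configuration \<Rightarrow> nat" where
  "config_des k c = max_des (replicate_mset k top)
     (map (case_option top enat \<circ> c) [0..<LEAST N. dom c \<subseteq> {..<N}])"

lemma config_des_eq:
  assumes "dom c \<subseteq> {..<N}" "k > 0"
  shows "config_des k c = max_des (replicate_mset k top) (map (case_option top enat \<circ> c) [0..<N])"
proof -
  define L where "L = (LEAST N. dom c \<subseteq> {..<N})"
  have L: "dom c \<subseteq> {..<L}" "L \<le> N"
    unfolding L_def using assms(1) by (auto intro: LeastI2 Least_le)
  then have "[0..<N] = [0..<L] @ [L..<N]" using upt_add_eq_append[of 0 L "N - L"] by simp
  moreover have "c j = None" if "L \<le> j" for j using L(1) that by (auto simp: dom_def)
  then have "map (case_option top enat \<circ> c) [L..<N] = replicate (N - L) top"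
    by (intro nth_equalityI) auto
  ultimately show ?thesis using assms(2) unfolding config_des_def L_def[symmetric]
    by (simp add: max_des_append_top)
qed

text \<open>The moving ball has the smallest key before its move and the largest finite one
  afterwards: unmoved balls have keys between \<open>b\<close> and \<open>K\<close>, moved ones are
  shifted from below \<open>b\<close> to below \<open>b + K\<close>. The boxes jumped over are full,
  as \<open>max_des_jump\<close> requires. The threshold guarantees that the target box is
  read.\<close>

lemma move_ball_box_key:
  assumes "valid S c" "sorted_wrt (<) (bs1 @ b # bs2)" "S = set (bs1 @ b # bs2)" "k > 0"
    and K: "\<And>x. x \<in> S \<Longrightarrow> x < K"
  shows "\<exists>N0. \<forall>N\<ge>N0. max_des (replicate_mset k top) (map (box_key K (set bs1) \<circ> c) [0..<N])
    = max_des (replicate_mset k top) (map (box_key K (insert b (set bs1)) \<circ> move_ball b c) [0..<N])"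
proof -
  have "b \<in> S" using assms(3) by simp
  then obtain p q where pq: "c p = Some b" "p < q" "c q = None"
    "\<And>j. p < j \<Longrightarrow> j < q \<Longrightarrow> c j \<noteq> None" "move_ball b c = c(p := None, q := Some b)"
    using valid_move_ball[OF assms(1)] by metis
  let ?f = "box_key K (set bs1) \<circ> c"
  let ?g = "box_key K (insert b (set bs1)) \<circ> move_ball b c"
  have b: "b < K" "b \<notin> set bs1" using K[OF \<open>b \<in> S\<close>] assms(2) by (auto simp: sorted_wrt_append)
  have same: "?f j = ?g j" if "j \<noteq> p" "j \<noteq> q" for j
    using that pq valid_unique[OF assms(1), of j b p]
    by (auto simp: box_key_def split: option.split)
  have range: "enat b < ?f j \<and> ?f j < enat (b + K)" if j: "j \<noteq> p" "c j \<noteq> None" for j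
  proof -
    obtain a where a: "c j = Some a" "a \<in> S" "a \<noteq> b"
      using j pq(1) valid_unique[OF assms(1), of j b p] valid_label[OF assms(1), of j] by auto
    then have "a < b \<longleftrightarrow> a \<in> set bs1" using assms(2,3) by (auto simp: sorted_wrt_append)
    then show ?thesis using a K[of a] b by (auto simp: box_key_def)
  qed
  have range': "enat b < ?f j \<and> (?f j = top \<or> ?f j < enat (b + K))" if "j \<noteq> p" for j
    using range[OF that] by (cases "c j") (auto simp: box_key_def top_enat_def)
  show ?thesis
  proof (intro exI allI impI)
    fix N assume N: "Suc q \<le> N"
    let ?A = "map ?f [0..<p]" and ?B = "map ?f [Suc p..<q]" and ?C = "map ?f [Suc q..<N]"
    have split: "[0..<N] = [0..<p] @ p # [Suc p..<q] @ q # [Suc q..<N]"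
    proof -
      have "[0..<N] = [0..<p] @ [p..<N]" using pq(2) N upt_add_eq_append[of 0 p "N - p"] by simp
      also have "[p..<N] = p # [Suc p..<N]" using pq(2) N by (simp add: upt_conv_Cons)
      also have "[Suc p..<N] = [Suc p..<q] @ [q..<N]"
        using pq(2) N upt_add_eq_append[of "Suc p" q "N - q"] by simp
      also have "[q..<N] = q # [Suc q..<N]" using N by (simp add: upt_conv_Cons)
      finally show ?thesis .
    qed
    have "map ?f [0..<N] = ?A @ enat b # ?B @ top # ?C"
      unfolding split using pq(1,3) b by (simp add: box_key_def)
    moreover have "map ?g [0..<N] = ?A @ top # ?B @ enat (b + K) # ?C"
      unfolding split using pq(2,5) same by (auto simp: box_key_def)
    moreover have "max_des (replicate_mset k top) (?A @ top # ?B @ enat (b + K) # ?C)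
        = max_des (replicate_mset k top) (?A @ enat b # ?B @ top # ?C)"
    proof (rule max_des_jump)
      show "enat b < x \<and> (x = top \<or> x < enat (b + K))"
        if "x \<in> set_mset (replicate_mset k top) \<union> set ?A" for x
      proof -
        from that consider "x = top" | j where "j < p" "x = ?f j" by (auto split: if_splits)
        then show ?thesis
        proof cases
          case 2
          then show ?thesis using range'[of j] by simp
        qed (simp add: top_enat_def)
      qed
      show "enat b < x \<and> x < enat (b + K)" if "x \<in> set ?B" for x
      proof -
        from that obtain j where "j \<in> {Suc p..<q}" "x = ?f j" unfolding set_map set_upt by blast
        then show ?thesis using range[of j] pq(4)[of j] by auto
      qed
      show "x = top \<or> x < enat (b + K)" if "x \<in> set ?C" for x
      proof -
        from that obtain j where "j \<in> {Suc q..<N}" "x = ?f j" unfolding set_map set_upt by blast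
        then show ?thesis using range'[of j] pq(2) by auto
      qed
    qed (use b assms(4) in \<open>auto simp: top_enat_def\<close>)
    ultimately show "max_des (replicate_mset k top) (map ?f [0..<N])
        = max_des (replicate_mset k top) (map ?g [0..<N])" by simp
  qed
qed

lemma fold_move_ball_box_key:
  assumes "valid S c" "sorted_wrt (<) (bs1 @ bs2)" "S = set (bs1 @ bs2)" "k > 0"
    and K: "\<And>x. x \<in> S \<Longrightarrow> x < K"
  shows "\<exists>N0. \<forall>N\<ge>N0. max_des (replicate_mset k top) (map (box_key K (set bs1) \<circ> c) [0..<N])
    = max_des (replicate_mset k top) (map (box_key K S \<circ> fold move_ball bs2 c) [0..<N])"
  using assms(1-3)
proof (induction bs2 arbitrary: bs1 c)
  case (Cons b bs2)
  have "valid S (move_ball b c)"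
    using valid_fold_move_ball[OF Cons.prems(1), of "[b]"] Cons.prems(3) by simp
  then have "\<exists>N1. \<forall>N\<ge>N1. max_des (replicate_mset k top)
       (map (box_key K (set (bs1 @ [b])) \<circ> move_ball b c) [0..<N])
    = max_des (replicate_mset k top) (map (box_key K S \<circ> fold move_ball bs2 (move_ball b c)) [0..<N])"
    by (rule Cons.IH) (use Cons.prems in auto)
  then obtain N1 where N1: "\<forall>N\<ge>N1. max_des (replicate_mset k top)
       (map (box_key K (set (bs1 @ [b])) \<circ> move_ball b c) [0..<N])
    = max_des (replicate_mset k top) (map (box_key K S \<circ> fold move_ball bs2 (move_ball b c)) [0..<N])" ..
  obtain N2 where N2: "\<forall>N\<ge>N2. max_des (replicate_mset k top) (map (box_key K (set bs1) \<circ> c) [0..<N])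
    = max_des (replicate_mset k top) (map (box_key K (insert b (set bs1)) \<circ> move_ball b c) [0..<N])"
    using move_ball_box_key[OF Cons.prems assms(4) K] by blast
  have eq: "set (bs1 @ [b]) = insert b (set bs1)" by simp
  show ?case
    using N1 N2 unfolding eq by (intro exI[of _ "max N1 N2"]) (simp add: comp_def)
qed simp

text \<open>Once all balls have moved, every key carries the same shift by \<open>K\<close>, which
  preserves the order and fixes infinity.\<close>

lemma config_des_BBS:
  assumes "valid (set bs) c" "sorted_wrt (<) bs" "k > 0"
  shows "config_des k (fold move_ball bs c) = config_des k c"
proof -
  let ?S = "set bs" and ?c = "fold move_ball bs c" and ?R = "replicate_mset k (top :: enat)"
  \<comment> \<open>The inserted \<open>0\<close> keeps \<open>Max\<close> meaningful when there is
    no ball.\<close>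
  define K where "K = Suc (Max (insert 0 ?S))"
  have K: "x < K" if "x \<in> ?S" for x using that by (simp add: K_def less_Suc_eq_le)
  obtain N0 where N0: "\<forall>N\<ge>N0. max_des ?R (map (box_key K {} \<circ> c) [0..<N])
    = max_des ?R (map (box_key K ?S \<circ> ?c) [0..<N])"
    using fold_move_ball_box_key[OF assms(1) _ _ assms(3) K, of "[]" bs] assms(2)
    by (simp only: append_Nil list.set) blast
  have val: "valid ?S ?c" using valid_fold_move_ball[OF assms(1)] by simp
  then obtain N1 where N1: "dom c \<union> dom ?c \<subseteq> {..<N1}"
    using assms(1) finite_nat_iff_bounded[of "dom c \<union> dom ?c"] by (auto simp: valid_def)
  define N where "N = max N0 N1"
  have N: "dom c \<subseteq> {..<N}" "dom ?c \<subseteq> {..<N}" "N0 \<le> N" using N1 unfolding N_def by auto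
  let ?sh = "\<lambda>x. x + enat K"
  have "box_key K ?S (?c j) = ?sh (case_option top enat (?c j))" for j
    using valid_label[OF val, of j] by (auto simp: box_key_def top_enat_def split: option.split)
  then have "map (box_key K ?S \<circ> ?c) [0..<N] = map ?sh (map (case_option top enat \<circ> ?c) [0..<N])"
    by simp
  moreover have "image_mset ?sh ?R = ?R" by (simp add: top_enat_def)
  moreover have "strict_mono_on A ?sh" for A
    by (auto simp: strict_mono_on_def)
  ultimately have "max_des ?R (map (box_key K ?S \<circ> ?c) [0..<N])
      = max_des ?R (map (case_option top enat \<circ> ?c) [0..<N])"
    using max_des_image[of ?R "map (case_option top enat \<circ> ?c) [0..<N]" ?sh] by metis
  moreover have "box_key K {} = case_option top enat" by (auto simp: box_key_def fun_eq_iff split: option.split)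
  ultimately show ?thesis
    using N0 N config_des_eq[OF N(1) assms(3)] config_des_eq[OF N(2) assms(3)] by simp
qed

section \<open>Arrangements of runs\<close>

text \<open>A list of positioned runs is given from right to left.\<close>

fun place_runs :: "(nat \<times> nat list) list \<Rightarrow> configuration" where
  "place_runs [] = (\<lambda>_. None)"
| "place_runs ((p, r) # P) =
     (\<lambda>q. if p \<le> q \<and> q < p + length r then Some (r ! (q - p)) else place_runs P q)"

text \<open>The last clause makes the runs maximal: touching runs meet in a descent. Hence the list
  is determined by the configuration.\<close>

fun arrangement :: "(nat \<times> nat list) list \<Rightarrow> bool" where
  "arrangement [] \<longleftrightarrow> True"
| "arrangement ((p, r) # P) \<longleftrightarrow> r \<noteq> [] \<and> sorted_wrt (<) r \<and> arrangement P \<and>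
     (case P of [] \<Rightarrow> True | (p', r') # _ \<Rightarrow>
        p' + length r' \<le> p \<and> (p' + length r' = p \<longrightarrow> hd r < last r'))"

lemma arrangement_before:
  "arrangement ((p, r) # P) \<Longrightarrow> (p', r') \<in> set P \<Longrightarrow> p' + length r' \<le> p"
proof (induction P arbitrary: p r)
  case (Cons a P)
  obtain p1 r1 where a: "a = (p1, r1)" by (cases a)
  then show ?case using Cons by (cases "(p', r') = a") fastforce+
qed simp

lemma place_runs_beyond: "arrangement ((p, r) # P) \<Longrightarrow> p \<le> q \<Longrightarrow> place_runs P q = None"
proof (induction P arbitrary: p r)
  case (Cons a P)
  obtain p1 r1 where a: "a = (p1, r1)" by (cases a)
  then show ?case using Cons.prems Cons.IH[of p1 r1] by auto
qed simp

lemma place_runs_mem: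
  "arrangement P \<Longrightarrow> (p, r) \<in> set P \<Longrightarrow> i < length r \<Longrightarrow> place_runs P (p + i) = Some (r ! i)"
proof (induction P)
  case (Cons a P)
  obtain p1 r1 where a: "a = (p1, r1)" by (cases a)
  show ?case
  proof (cases "(p, r) = a")
    case False
    then have "p + length r \<le> p1" using arrangement_before[of p1 r1 P p r] Cons.prems a by auto
    then show ?thesis using Cons a False by auto
  qed (use Cons.prems a in simp)
qed simp

lemma place_runs_SomeD:
  "place_runs P q = Some b \<Longrightarrow> \<exists>(p, r) \<in> set P. p \<le> q \<and> q < p + length r \<and> b = r ! (q - p)"
proof (induction P)
  case (Cons a P)
  obtain p1 r1 where a: "a = (p1, r1)" by (cases a)
  show ?case using Cons by (cases "p1 \<le> q \<and> q < p1 + length r1") (auto simp: a)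
qed simp

lemma arrangement_mem: "arrangement P \<Longrightarrow> (p, r) \<in> set P \<Longrightarrow> r \<noteq> [] \<and> sorted_wrt (<) r"
  by (induction P) auto

text \<open>A block crossing the left end of a run would contain the fall of labels between two
  touching runs.\<close>

lemma increasing_block_place_runs:
  "arrangement P \<Longrightarrow> increasing_block (place_runs P) p r \<Longrightarrow>
     \<exists>(p0, r0) \<in> set P. p0 \<le> p \<and> p + length r \<le> p0 + length r0"
proof (induction P)
  case Nil
  then show ?case by (auto simp: increasing_block_def)
next
  case (Cons a P)
  obtain p1 r1 where a [simp]: "a = (p1, r1)" by (cases a)
  have r: "r \<noteq> []" "\<And>k. k < length r \<Longrightarrow> place_runs (a # P) (p + k) = Some (r ! k)" "sorted_wrt (<) r"
    using Cons.prems by (auto simp: increasing_block_def)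
  consider "p + length r \<le> p1" | "p < p1" "p1 < p + length r" | "p1 \<le> p" by linarith
  then show ?case
  proof cases
    case 1
    have "increasing_block (place_runs P) p r"
      unfolding increasing_block_def
    proof (intro conjI allI impI r(1,3))
      fix k assume "k < length r"
      with r(2)[OF this] 1 show "place_runs P (p + k) = Some (r ! k)" by (simp split: if_splits)
    qed
    then show ?thesis using Cons by auto
  next
    case 2
    \<comment> \<open>\<open>p + k\<close> is the last box before the run at \<open>p1\<close>, so
      entries \<open>k\<close> and \<open>Suc k\<close> of the block straddle the boundary.\<close>
    define k where "k = p1 - p - 1"
    have k: "Suc k < length r" "p + Suc k = p1" using 2 by (auto simp: k_def)
    have 3: "place_runs P (p + k) = Some (r ! k)" using r(2)[of k] k by (auto split: if_splits)
    then obtain p2 r2 P' where P: "P = (p2, r2) # P'" by (cases P) auto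
    have "p + k < p2 + length r2"
    proof (rule ccontr)
      assume "\<not> ?thesis"
      then have "place_runs P (p + k) = None"
        using P Cons.prems(1) place_runs_beyond[of p2 r2 P' "p + k"] by auto
      then show False using 3 by simp
    qed
    then have adj: "p2 + length r2 = p1" "hd r1 < last r2" "r2 \<noteq> []" "r1 \<noteq> []" using P Cons.prems(1) k by auto
    have "place_runs P (p2 + (length r2 - 1)) = Some (r2 ! (length r2 - 1))"
      using P Cons.prems(1) adj by (intro place_runs_mem) auto
    moreover have "p2 + (length r2 - 1) = p + k" using adj k by (cases r2) auto
    ultimately have "r ! k = last r2" using 3 adj by (simp add: last_conv_nth)
    moreover have "r ! Suc k = hd r1" using r(2)[of "Suc k"] k adj by (simp add: hd_conv_nth)
    ultimately show ?thesis using sorted_wrt_nth_less[OF r(3), of k "Suc k"] k(1) adj by simp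
  next
    case 3
    have "p + length r \<le> p1 + length r1"
    proof (rule ccontr)
      assume "\<not> ?thesis"
      then have "place_runs (a # P) (p + (length r - 1)) = None"
        using 3 Cons.prems(1) place_runs_beyond[of p1 r1 P "p + (length r - 1)"] by auto
      then show False using r(1) r(2)[of "length r - 1"] by simp
    qed
    then show ?thesis using 3 by auto
  qed
qed

lemma increasing_block_mem:
  "arrangement P \<Longrightarrow> (p, r) \<in> set P \<Longrightarrow> increasing_block (place_runs P) p r"
  using arrangement_mem[of P p r] place_runs_mem[of P p r] by (simp add: increasing_block_def)

lemma increasing_block_unique:
  assumes "increasing_block c p r" "increasing_block c p r'" "length r = length r'"
  shows "r = r'"
proof (rule nth_equalityI[OF assms(3)])
  fix i assume "i < length r"
  then have "c (p + i) = Some (r ! i)" "c (p + i) = Some (r' ! i)"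
    using assms by (auto simp: increasing_block_def)
  then show "r ! i = r' ! i" by simp
qed

lemma increasing_run_place_runs:
  assumes "arrangement P"
  shows "increasing_run (place_runs P) p r \<longleftrightarrow> (p, r) \<in> set P"
proof
  assume run: "increasing_run (place_runs P) p r"
  then obtain p0 r0 where *: "(p0, r0) \<in> set P" "p0 \<le> p" "p + length r \<le> p0 + length r0"
    using increasing_block_place_runs[OF assms] unfolding increasing_run_def by blast
  then have "increasing_block (place_runs P) p0 r0" "{p..<p + length r} \<subseteq> {p0..<p0 + length r0}"
    using increasing_block_mem[OF assms] by auto
  then show "(p, r) \<in> set P" using run * unfolding increasing_run_def by blast
next
  assume mem: "(p, r) \<in> set P"
  have block: "increasing_block (place_runs P) p r" using increasing_block_mem[OF assms mem] .
  have r: "r \<noteq> []" using arrangement_mem[OF assms mem] by simp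
  show "increasing_run (place_runs P) p r"
    unfolding increasing_run_def
  proof (rule conjI[OF block], intro allI impI)
    fix p' r' assume *: "increasing_block (place_runs P) p' r' \<and> {p..<p + length r} \<subseteq> {p'..<p' + length r'}"
    then have sub: "p' \<le> p" "p + length r \<le> p' + length r'" using r by auto
    obtain p0 r0 where 0: "(p0, r0) \<in> set P" "p0 \<le> p'" "p' + length r' \<le> p0 + length r0"
      using * increasing_block_place_runs[OF assms] by blast
    have "(p0, r0) = (p, r)"
    proof (rule ccontr)
      assume neq: "(p0, r0) \<noteq> (p, r)"
      have "p + length r \<le> p0 \<or> p0 + length r0 \<le> p"
        using assms 0(1) mem neq
      proof (induction P)
        case (Cons a P)
        obtain p1 r1 where "a = (p1, r1)" by (cases a)
        then show ?case using Cons arrangement_before[of p1 r1 P] by auto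
      qed simp
      then show False using sub 0 r by (cases r) auto
    qed
    then have "p' = p" "length r' = length r" using sub 0 by auto
    then show "p' = p \<and> r' = r" using increasing_block_unique[of "place_runs P" p r' r] * block by auto
  qed
qed

lemma map_fst_arrangement:
  assumes "arrangement P"
  shows "map fst P = rev (sorted_list_of_set {p. \<exists>r. increasing_run (place_runs P) p r})"
proof -
  have "{p. \<exists>r. increasing_run (place_runs P) p r} = set (rev (map fst P))"
    using increasing_run_place_runs[OF assms] by force
  moreover have "sorted_wrt (<) (rev (map fst P))"
    using assms
  proof (induction P)
    case (Cons a P)
    obtain p1 r1 where a: "a = (p1, r1)" by (cases a)
    have "p < p1" if "(p, r) \<in> set P" for p r
      using arrangement_before[of p1 r1 P p r] arrangement_mem[of P p r] Cons.prems a that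
      by (cases r) auto
    then show ?case using Cons a by (auto simp: sorted_wrt_append)
  qed simp
  ultimately show ?thesis
    by (metis sorted_list_of_set.idem_if_sorted_distinct strict_sorted_iff rev_rev_ident)
qed

lemma runs_from_right_place_runs:
  assumes "arrangement P"
  shows "runs_from_right (place_runs P) = map snd P"
proof -
  have uniq: "r = r'" if "(p, r) \<in> set P" "(p, r') \<in> set P" for p r r'
    using assms that
  proof (induction P)
    case (Cons a P)
    obtain p1 r1 where a: "a = (p1, r1)" by (cases a)
    have "p + length r \<le> p1" if "(p, r) \<in> set P" for r
      using arrangement_before[of p1 r1 P] Cons.prems(1) a that by auto
    moreover have "r \<noteq> []" if "(p, r) \<in> set P" for r
      using arrangement_mem[of P p r] Cons.prems(1) a that by auto
    ultimately show ?case using Cons a by fastforce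
  qed simp
  have "(THE r. increasing_run (place_runs P) p r) = r" if "(p, r) \<in> set P" for p r
    unfolding increasing_run_place_runs[OF assms] using that uniq by blast
  then show ?thesis
    unfolding runs_from_right_def map_fst_arrangement[OF assms, symmetric] by auto
qed

lemma arrangement_unique:
  assumes "arrangement P" "arrangement Q" "place_runs P = place_runs Q"
  shows "P = Q"
proof -
  have "map fst P = map fst Q" "map snd P = map snd Q"
    using assms map_fst_arrangement runs_from_right_place_runs by metis+
  then show ?thesis by (metis zip_map_fst_snd)
qed

text \<open>By induction on a bound for the occupied boxes: a ball in the last box either extends
  the rightmost run or opens a new one.\<close>

lemma arrangement_exists:
  assumes "finite (dom c)" "inj_on c (dom c)"
  obtains P where "arrangement P" "place_runs P = c"
proof -
  obtain N where "dom c \<subseteq> {..<N}" using assms(1) finite_nat_iff_bounded by auto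
  then have "\<exists>P. arrangement P \<and> place_runs P = c" using assms(2)
  proof (induction N arbitrary: c)
    case 0
    then have "c = place_runs []" by (auto simp: fun_eq_iff dom_def)
    then show ?case by (metis arrangement.simps(1))
  next
    case (Suc N)
    show ?case
    proof (cases "c N")
      case None
      then have "dom c \<subseteq> {..<N}" using Suc.prems(1)
        by (metis domIff lessThan_Suc subset_insert)
      then show ?thesis using Suc by blast
    next
      case (Some b)
      let ?c = "c(N := None)"
      have "dom ?c \<subseteq> {..<N}" "inj_on ?c (dom ?c)"
        using Suc.prems by (auto simp: less_Suc_eq inj_on_def)
      then obtain P where P: "arrangement P" "place_runs P = ?c" using Suc.IH by blast
      have c: "c = (place_runs P)(N := Some b)" unfolding P(2) using Some by auto
      have N: "(p, r) \<in> set P \<Longrightarrow> p + length r \<le> N" for p r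
      proof -
        assume pr: "(p, r) \<in> set P"
        then have "r \<noteq> []" using arrangement_mem[OF P(1)] by blast
        then have "place_runs P (p + (length r - 1)) \<noteq> None" using place_runs_mem[OF P(1) pr] by auto
        then have "p + (length r - 1) \<in> dom ?c" unfolding P(2) by (rule domIff[THEN iffD2])
        then have "p + (length r - 1) < N" using \<open>dom ?c \<subseteq> {..<N}\<close> by blast
        then show ?thesis using \<open>r \<noteq> []\<close> by (cases r) auto
      qed
      show ?thesis
      proof (cases "\<exists>p r P'. P = (p, r) # P' \<and> p + length r = N \<and> last r < b")
        case True
        then obtain p r P' where *: "P = (p, r) # P'" "p + length r = N" "last r < b" by blast
        have "sorted_wrt (<) (r @ [b])"
        proof -
          have r: "sorted_wrt (<) r" "r \<noteq> []" using * P(1) by auto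
          have "x < b" if x: "x \<in> set r" for x
          proof -
            obtain i where i: "i < length r" "r ! i = x" using x unfolding in_set_conv_nth by blast
            then have "x \<le> last r"
            proof (cases "i = length r - 1")
              case True
              then show ?thesis using i r(2) by (simp add: last_conv_nth)
            next
              case False
              then have "i < length r - 1" using i by linarith
              then show ?thesis
                using sorted_wrt_nth_less[OF r(1), of i "length r - 1"] i r(2)
                by (simp add: last_conv_nth)
            qed
            then show ?thesis using * by simp
          qed
          then show "sorted_wrt (<) (r @ [b])" using r by (auto simp: sorted_wrt_append)
        qed
        moreover have "last r < b" "r \<noteq> []" using * P(1) by auto
        ultimately have "arrangement ((p, r @ [b]) # P')" using * P(1) by (auto split: list.splits)
        moreover have "place_runs ((p, r @ [b]) # P') = c"
          unfolding c using * by (auto simp: fun_eq_iff nth_append)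
        ultimately show ?thesis by blast
      next
        case False
        have "arrangement ((N, [b]) # P)"
        proof (cases P)
          case (Cons a P')
          obtain p r where a: "a = (p, r)" by (cases a)
          \<comment> \<open>Injectivity excludes \<open>last r = b\<close>, so failing to extend the
            run means a strict fall.\<close>
          have "p + length r = N \<longrightarrow> b < last r"
          proof
            assume pN: "p + length r = N"
            have r: "r \<noteq> []" using P(1) Cons a by simp
            have "place_runs P (p + (length r - 1)) = Some (r ! (length r - 1))"
              using Cons a r by (intro place_runs_mem[OF P(1)]) auto
            moreover have N1: "N - 1 = p + (length r - 1)" "N - 1 \<noteq> N" using pN r by (cases r; simp)+
            ultimately have "?c (N - 1) = Some (last r)" using r P(2) by (simp only: N1 last_conv_nth not_False_eq_True)
            then have "c (N - 1) = Some (last r)" "N - 1 \<noteq> N" using N1(2) by simp_all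
            then have "last r \<noteq> b" using Suc.prems(2) Some unfolding inj_on_def by (metis domI)
            then show "b < last r" using False Cons a pN by force
          qed
          then show ?thesis using Cons a P N[of p r] by auto
        qed simp
        moreover have "place_runs ((N, [b]) # P) = c"
          unfolding c by (auto simp: fun_eq_iff)
        ultimately show ?thesis by blast
      qed
    qed
  qed
  then show ?thesis using that by blast
qed

section \<open>Descent numbers of an arrangement of runs\<close>

abbreviation readout :: "configuration \<Rightarrow> nat \<Rightarrow> enat list" where
  "readout c N \<equiv> map (case_option top enat \<circ> c) [0..<N]"

fun right_end :: "(nat \<times> nat list) list \<Rightarrow> nat" where
  "right_end [] = 0"
| "right_end ((p, r) # P) = p + length r"

lemma dom_place_runs:
  assumes "arrangement P"
  shows "dom (place_runs P) \<subseteq> {..<right_end P}"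
proof
  fix q assume "q \<in> dom (place_runs P)"
  then obtain b where "place_runs P q = Some b" by blast
  then obtain p' r' where *: "(p', r') \<in> set P" "q < p' + length r'"
    using place_runs_SomeD by blast
  then obtain p r P' where P: "P = (p, r) # P'" by (cases P) auto
  show "q \<in> {..<right_end P}"
  proof (cases "(p', r') = (p, r)")
    case False
    then have "p' + length r' \<le> p" using arrangement_before[of p r P'] assms * P by auto
    then show ?thesis using * P by simp
  qed (use * P in auto)
qed

lemma arrangement_right_end: "arrangement ((p, r) # P) \<Longrightarrow> right_end P \<le> p"
  by (cases P) auto

lemma readout_Cons:
  assumes "arrangement ((p, r) # P)" "p + length r \<le> N"
  shows "readout (place_runs ((p, r) # P)) N
    = readout (place_runs P) p @ map enat r @ replicate (N - (p + length r)) top"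
proof -
  have "[0..<N] = [0..<p] @ [p..<p + length r] @ [p + length r..<N]"
    using assms(2) upt_add_eq_append[of 0 p "N - p"] upt_add_eq_append[of p "p + length r" "N - (p + length r)"]
    by simp
  moreover have "readout (place_runs ((p, r) # P)) p = readout (place_runs P) p" by simp
  moreover have "map (case_option top enat \<circ> place_runs ((p, r) # P)) [p..<p + length r] = map enat r"
    by (rule nth_equalityI) auto
  moreover have "map (case_option top enat \<circ> place_runs ((p, r) # P)) [p + length r..<N]
      = replicate (N - (p + length r)) top"
    using place_runs_beyond[OF assms(1)] by (intro nth_equalityI) auto
  ultimately show ?thesis by (simp only: map_append)
qed

lemma readout_Nil: "readout (place_runs []) N = replicate N top"
  by (rule nth_equalityI) auto

lemma max_des_singleton_run:
  "r \<noteq> [] \<Longrightarrow> sorted_wrt (<) r \<Longrightarrow>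
     max_des {#a#} (map enat r @ ys) = of_bool (enat (hd r) < a) + max_des {#enat (last r)#} ys"
proof (induction r arbitrary: a)
  case (Cons x r)
  then show ?case
    by (cases r) (auto simp: max_des_singleton)
qed simp

lemma max_des_singleton_tops:
  "max_des {#a#} (replicate j top @ ys) = max_des {#if j = 0 then a else top#} (ys :: enat list)"
  by (induction j arbitrary: a) (auto simp: max_des_singleton top_enat_def)

text \<open>Each run contributes exactly one descent, at its first ball: from infinity at the start
  or after a gap, and otherwise from the last ball of the touching run. The state at the cut depends
  on whether the rightmost run reaches it.\<close>

lemma max_des_1_place_runs:
  assumes "arrangement P" "right_end P \<le> N"
  shows "max_des {#top#} (readout (place_runs P) N @ ys) = length P
    + max_des {#if P \<noteq> [] \<and> right_end P = N then enat (last (snd (hd P))) else top#} ys"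
  using assms
proof (induction P arbitrary: N ys)
  case Nil
  then show ?case by (simp only: readout_Nil max_des_singleton_tops) simp
next
  case (Cons a P)
  obtain p r where a [simp]: "a = (p, r)" by (cases a)
  let ?zs = "map enat r @ replicate (N - (p + length r)) top @ ys"
  let ?st = "if P \<noteq> [] \<and> right_end P = p then enat (last (snd (hd P))) else top"
  have r: "r \<noteq> []" "sorted_wrt (<) r" using Cons.prems by auto
  have "max_des {#top#} (readout (place_runs (a # P)) N @ ys)
      = max_des {#top#} (readout (place_runs P) p @ ?zs)"
    using Cons.prems by (simp only: a readout_Cons right_end.simps append.assoc)
  also have "\<dots> = length P + max_des {#?st#} ?zs"
    using Cons.prems arrangement_right_end[of p r P] by (intro Cons.IH) auto
  also have "max_des {#?st#} ?zs = of_bool (enat (hd r) < ?st)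
      + max_des {#if N - (p + length r) = 0 then enat (last r) else top#} ys"
    unfolding max_des_singleton_run[OF r] max_des_singleton_tops ..
  also have "of_bool (enat (hd r) < ?st) = (1 :: nat)"
    using Cons.prems by (cases P) (auto simp: top_enat_def)
  also have "(if N - (p + length r) = 0 then enat (last r) else top)
      = (if a # P \<noteq> [] \<and> right_end (a # P) = N then enat (last (snd (hd (a # P)))) else top)"
    using Cons.prems by auto
  finally show ?case by (simp only: list.size)
qed

lemma config_des_1_place_runs: "arrangement P \<Longrightarrow> config_des 1 (place_runs P) = length P"
  using max_des_1_place_runs[of P "right_end P" "[]"] dom_place_runs[of P]
  by (simp add: config_des_eq)

text \<open>The condition on \<open>i\<close> and \<open>j\<close> says that the ball \<open>r' ! j\<close>, which moves by \<open>length r'\<close>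
  boxes, finds its target box already vacated by \<open>r ! i\<close>.\<close>

fun well_spaced :: "(nat \<times> nat list) list \<Rightarrow> bool" where
  "well_spaced [] \<longleftrightarrow> True"
| "well_spaced ((p, r) # P) \<longleftrightarrow> well_spaced P \<and>
     (case P of [] \<Rightarrow> True | (p', r') # _ \<Rightarrow> length r' \<le> length r \<and>
        (\<forall>i j. i < length r \<longrightarrow> j < length r' \<longrightarrow> p + i = p' + length r' + j \<longrightarrow> r ! i < r' ! j))"

text \<open>Optimal choices of last letters: the first \<open>k\<close> balls of a run extend the \<open>k\<close> subsequences,
  and every empty box takes the place of the smallest last letter.\<close>

definition run_state :: "nat \<Rightarrow> nat list \<Rightarrow> enat list" where
  "run_state k r = map enat (take k r) @ replicate (k - length r) top"

definition gap_state :: "nat \<Rightarrow> enat list \<Rightarrow> enat list" where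
  "gap_state g L = drop g L @ replicate (min g (length L)) top"

definition arrangement_state :: "nat \<Rightarrow> (nat \<times> nat list) list \<Rightarrow> nat \<Rightarrow> enat list" where
  "arrangement_state k P N = (case P of [] \<Rightarrow> replicate k top
     | (p, r) # _ \<Rightarrow> gap_state (N - (p + length r)) (run_state k r))"

lemma length_run_state [simp]: "length (run_state k r) = k"
  by (simp add: run_state_def)

lemma length_gap_state [simp]: "length (gap_state g L) = length L"
  by (simp add: gap_state_def)

lemma length_arrangement_state [simp]: "length (arrangement_state k P N) = k"
  by (auto simp: arrangement_state_def split: list.split)

lemma nth_run_state: "i < k \<Longrightarrow> run_state k r ! i = (if i < length r then enat (r ! i) else top)"
  by (auto simp: run_state_def nth_append)

lemma nth_gap_state:
  "i < length L \<Longrightarrow> gap_state g L ! i = (if i + g < length L then L ! (i + g) else top)"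
  by (auto simp: gap_state_def nth_append add.commute intro!: nth_replicate)

lemma max_des_gap:
  "L \<noteq> [] \<Longrightarrow> max_des (mset (gap_state g L)) ys \<le> max_des (mset L) (replicate g top @ ys)"
proof (induction g arbitrary: L)
  case 0
  then show ?case by (simp add: gap_state_def)
next
  case (Suc g)
  obtain a L' where L: "L = a # L'" using Suc.prems by (cases L) auto
  have "mset (gap_state (Suc g) L) = mset (gap_state g (L' @ [top]))"
    by (cases "g \<le> length L'") (auto simp: gap_state_def L min_def le_Suc_eq)
  then have "max_des (mset (gap_state (Suc g) L)) ys \<le> max_des (mset (L' @ [top])) (replicate g top @ ys)"
    using Suc.IH[of "L' @ [top]"] by simp
  also have "\<dots> \<le> max_des (mset L) (top # replicate g top @ ys)"
    using max_des_ge[of top a "mset L'" "replicate g top @ ys"] by (simp add: L)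
  finally show ?case by simp
qed

text \<open>The spacing condition is used with \<open>j = i + ?g\<close>: after \<open>?g\<close>
  empty boxes, entry \<open>i\<close> of the state is the ball \<open>r' ! (i + ?g)\<close>, or
  infinity if that index is out of range.\<close>

lemma arrangement_state_greater:
  assumes "arrangement ((p, r) # P)" "well_spaced ((p, r) # P)" "i < k" "i < length r"
  shows "enat (r ! i) < arrangement_state k P p ! i"
proof (cases P)
  case Nil
  then show ?thesis using assms by (simp add: arrangement_state_def top_enat_def)
next
  case (Cons a P')
  obtain p' r' where a: "a = (p', r')" by (cases a)
  let ?g = "p - (p' + length r')"
  show ?thesis
  proof (cases "i + ?g < k \<and> i + ?g < length r'")
    case True
    have "r ! i < r' ! (i + ?g)"
      using assms True Cons a by (auto simp: add.commute)
    then show ?thesis using True assms(3) unfolding Cons a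
      by (simp add: arrangement_state_def nth_gap_state nth_run_state)
  next
    case False
    then have "arrangement_state k P p ! i = top" using assms(3) unfolding Cons a
      by (auto simp: arrangement_state_def nth_gap_state nth_run_state)
    then show ?thesis by (simp add: top_enat_def)
  qed
qed

text \<open>The run to the left is at most as long as \<open>r\<close>, so the last letters that
  \<open>r\<close> does not replace are infinite. This is why the state depends on the rightmost run
  alone.\<close>

lemma drop_arrangement_state:
  assumes "arrangement ((p, r) # P)" "well_spaced ((p, r) # P)"
  shows "drop (length r) (arrangement_state k P p) = replicate (k - length r) top"
proof (rule nth_equalityI)
  fix i assume i: "i < length (drop (length r) (arrangement_state k P p))"
  then have "arrangement_state k P p ! (length r + i) = top"
  proof (cases P)
    case (Cons a P')
    obtain p' r' where a: "a = (p', r')" by (cases a)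
    have "length r' \<le> length r" using assms(2) Cons a by simp
    then show ?thesis using i unfolding Cons a
      by (auto simp: arrangement_state_def nth_gap_state nth_run_state)
  qed (simp add: arrangement_state_def)
  then show "drop (length r) (arrangement_state k P p) ! i = replicate (k - length r) top ! i"
    using i by simp
qed simp

text \<open>Lower bound from the explicit choice. The induction removes the rightmost run, which is
  the end of the word, so an arbitrary continuation \<open>ys\<close> is carried along.\<close>

lemma max_des_well_spaced:
  assumes "arrangement P" "well_spaced P" "right_end P \<le> N" "k > 0"
  shows "(\<Sum>(p, r)\<leftarrow>P. min k (length r)) + max_des (mset (arrangement_state k P N)) ys
    \<le> max_des (replicate_mset k top) (readout (place_runs P) N @ ys)"
  using assms(1-3)
proof (induction P arbitrary: N ys)
  case Nil
  have "max_des (replicate_mset k top) ys \<le> max_des (replicate_mset k top) (replicate N top @ ys)"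
    using assms(4) by (intro max_des_skip_append) auto
  then show ?case
    by (simp only: readout_Nil) (simp add: arrangement_state_def)
next
  case (Cons a P)
  obtain p r where a [simp]: "a = (p, r)" by (cases a)
  let ?L = "arrangement_state k P p" and ?g = "N - (p + length r)"
  let ?zs = "replicate ?g top @ ys"
  have "max_des (mset (arrangement_state k (a # P) N)) ys \<le> max_des (mset (run_state k r)) ?zs"
    using max_des_gap[of "run_state k r" ?g ys] assms(4)
    by (simp add: arrangement_state_def flip: length_0_conv)
  moreover have "min k (length r) + max_des (mset (run_state k r)) ?zs \<le> max_des (mset ?L) (map enat r @ ?zs)"
  proof -
    have "mset ?L \<noteq> {#}" using assms(4) length_arrangement_state[of k P p] by (metis length_0_conv less_numeral_extra(3) mset_zero_iff)
    then show ?thesis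
      using max_des_decrease[of ?L "map enat r" "{#}" ?zs] arrangement_state_greater[of p r P]
        drop_arrangement_state[of p r P k] Cons.prems
      by (simp add: run_state_def take_map)
  qed
  moreover have "(\<Sum>(p, r)\<leftarrow>P. min k (length r)) + max_des (mset ?L) (map enat r @ ?zs)
    \<le> max_des (replicate_mset k top) (readout (place_runs (a # P)) N @ ys)"
  proof -
    have "(\<Sum>(p, r)\<leftarrow>P. min k (length r)) + max_des (mset ?L) (map enat r @ ?zs)
      \<le> max_des (replicate_mset k top) (readout (place_runs P) p @ map enat r @ ?zs)"
      using Cons.prems arrangement_right_end[of p r P] by (intro Cons.IH) auto
    also have "readout (place_runs P) p @ map enat r @ ?zs = readout (place_runs (a # P)) N @ ys"
      using Cons.prems by (simp only: a readout_Cons right_end.simps append.assoc)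
    finally show ?thesis .
  qed
  moreover have "(\<Sum>(p, r)\<leftarrow>a # P. min k (length r))
      = min k (length r) + (\<Sum>(p, r)\<leftarrow>P. min k (length r))" by simp
  ultimately show ?case by linarith
qed

text \<open>Upper bound: cut the word after each run. By \<open>max_des_append_le\<close> the pieces
  add up, and an increasing piece has at most \<open>min k (length r)\<close> descents.\<close>

lemma max_des_arrangement_le:
  assumes "arrangement P" "right_end P \<le> N" "k > 0"
  shows "max_des (replicate_mset k top) (readout (place_runs P) N) \<le> (\<Sum>(p, r)\<leftarrow>P. min k (length r))"
  using assms(1,2)
proof (induction P arbitrary: N)
  case Nil
  show ?case unfolding readout_Nil using max_des_append_top[of "replicate_mset k top" "[]" N] assms(3) by simp
next
  case (Cons a P)
  obtain p r where a [simp]: "a = (p, r)" by (cases a)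
  let ?R = "replicate_mset k (top :: enat)" and ?A = "readout (place_runs P) p"
  have R: "?R \<noteq> {#}" using assms(3) by auto
  have "readout (place_runs (a # P)) N = (?A @ map enat r) @ replicate (N - (p + length r)) top"
    using Cons.prems by (simp only: a readout_Cons right_end.simps append.assoc)
  then have "max_des ?R (readout (place_runs (a # P)) N) = max_des ?R (?A @ map enat r)"
    by (simp only: max_des_append_top[OF R])
  also have "\<dots> \<le> max_des ?R ?A + max_des ?R (map enat r)"
    using max_des_append_le[OF R, of ?A "map enat r"] by simp
  also have "max_des ?R (map enat r) \<le> min k (length r)"
    using max_des_increasing[of "map enat r" ?R] R Cons.prems by (auto simp: sorted_wrt_map)
  also have "max_des ?R ?A \<le> (\<Sum>(p, r)\<leftarrow>P. min k (length r))"
    using Cons.prems arrangement_right_end[of p r P] by (intro Cons.IH) auto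
  also have "(\<Sum>(p, r)\<leftarrow>P. min k (length r)) + min k (length r) = (\<Sum>(p, r)\<leftarrow>a # P. min k (length r))"
    by simp
  finally show ?case by this simp_all
qed

lemma config_des_well_spaced:
  assumes "arrangement P" "well_spaced P" "k > 0"
  shows "config_des k (place_runs P) = (\<Sum>(p, r)\<leftarrow>P. min k (length r))"
  using max_des_well_spaced[OF assms(1,2) order_refl assms(3), of "[]"]
    max_des_arrangement_le[OF assms(1) order_refl assms(3)]
  by (simp add: config_des_eq[OF dom_place_runs[OF assms(1)] assms(3)])

lemma config_des_initial:
  assumes "k > 0"
  shows "config_des k (initial_configuration w) = word_des k w"
proof -
  have "dom (initial_configuration w) \<subseteq> {..<length w}"
    by (auto simp: initial_configuration_def split: if_splits)
  moreover have "map (case_option top enat \<circ> initial_configuration w) [0..<length w] = map enat w"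
    by (rule nth_equalityI) (auto simp: initial_configuration_def)
  ultimately show ?thesis using assms by (simp add: config_des_eq word_des_def)
qed

text \<open>The differences of the sums in \<open>k\<close> count the parts exceeding
  \<open>k\<close>, which are the columns of the diagram; differences of these give the multiplicity
  of each part.\<close>

lemma sorted_eq_if_min_sums_eq:
  assumes "\<And>k. k > 0 \<Longrightarrow> (\<Sum>x\<leftarrow>xs. min k x) = (\<Sum>x\<leftarrow>ys. min k x)"
    and "sorted_wrt (\<ge>) xs" "sorted_wrt (\<ge>) ys" "0 \<notin> set xs" "0 \<notin> set (ys :: nat list)"
  shows "xs = ys"
proof -
  have count_ge: "(\<Sum>x\<leftarrow>zs. min (Suc k) x) = (\<Sum>x\<leftarrow>zs. min k x) + length (filter (\<lambda>x. k < x) zs)" for zs k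
    by (induction zs) auto
  have count: "length (filter (\<lambda>x. k < x) zs) = count (mset zs) (Suc k) + length (filter (\<lambda>x. Suc k < x) zs)" for zs k
    by (induction zs) auto
  have "(\<Sum>x\<leftarrow>xs. min k x) = (\<Sum>x\<leftarrow>ys. min k x)" for k
    using assms(1)[of k] by (cases k) (auto simp: min_def comp_def)
  then have "length (filter (\<lambda>x. k < x) xs) = length (filter (\<lambda>x. k < x) ys)" for k
    using count_ge[of k xs] count_ge[of k ys] by simp
  then have pos: "count (mset xs) (Suc k) = count (mset ys) (Suc k)" for k
    using count[of k xs] count[of k ys] by simp
  have zero: "count (mset zs) 0 = 0" if "0 \<notin> set zs" for zs :: "nat list"
    using that by (simp add: count_eq_zero_iff)
  have "count (mset xs) 0 = count (mset ys) 0"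
    by (simp only: zero[OF assms(4)] zero[OF assms(5)])
  with pos have "mset xs = mset ys" by (intro multiset_eqI) (metis not0_implies_Suc)
  moreover have "sorted (rev xs)" "sorted (rev ys)" using assms(2,3) by (simp_all add: sorted_wrt_rev)
  ultimately have "rev xs = rev ys" by (metis mset_rev properties_for_sort)
  then show ?thesis by simp
qed

declare place_runs.simps(2) [simp del]

lemma move_ball_eq:
  assumes "\<And>j. c j = Some b \<longleftrightarrow> j = p" "p < q" "c q = None" "\<And>j. p < j \<Longrightarrow> j < q \<Longrightarrow> c j \<noteq> None"
  shows "move_ball b c = c(p := None, q := Some b)"
proof -
  have "(THE j. c j = Some b) = p" using assms(1) by simp
  moreover have "(LEAST j. p < j \<and> c j = None) = q"
  proof (rule Least_equality)
    show "q \<le> y" if "p < y \<and> c y = None" for y using that assms(4)[of y] by (meson not_less)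
  qed (use assms in blast)
  ultimately show ?thesis by (simp add: move_ball_def)
qed

section \<open>Dynamics of the rightmost run\<close>

definition erase :: "nat set \<Rightarrow> configuration \<Rightarrow> configuration" where
  "erase R c = (\<lambda>q. if c q \<in> Some ` R then None else c q)"

lemma erase_place_runs:
  assumes "arrangement ((p, r) # P)" "valid S (place_runs ((p, r) # P))"
  shows "erase (set r) (place_runs ((p, r) # P)) = place_runs P"
proof
  fix q
  let ?c = "place_runs ((p, r) # P)"
  show "erase (set r) ?c q = place_runs P q"
  proof (cases "p \<le> q \<and> q < p + length r")
    case True
    then have "r ! (q - p) \<in> set r" by (intro nth_mem) auto
    then show ?thesis using True place_runs_beyond[OF assms(1)]
      by (simp add: erase_def place_runs.simps)
  next
    case False
    have "?c q \<notin> Some ` set r"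
    proof
      assume "?c q \<in> Some ` set r"
      then obtain i where i: "i < length r" "?c q = Some (r ! i)" by (auto simp: in_set_conv_nth)
      moreover have "?c (p + i) = Some (r ! i)" using i by (simp add: place_runs.simps)
      ultimately show False using valid_unique[OF assms(2)] False
        by (metis add_less_cancel_left le_add1)
    qed
    then show ?thesis using False by (auto simp: erase_def place_runs.simps)
  qed
qed

lemma valid_erase:
  assumes "valid S c"
  shows "valid (S - R) (erase R c)"
proof -
  have iff: "erase R c q = Some b \<longleftrightarrow> c q = Some b \<and> b \<notin> R" for q b
    by (auto simp: erase_def)
  have "inj_on (erase R c) (dom (erase R c))"
  proof (rule inj_onI)
    fix x y assume "x \<in> dom (erase R c)" "erase R c x = erase R c y"
    then obtain b where "erase R c x = Some b" "erase R c y = Some b" by (metis domD)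
    then show "x = y" using valid_unique[OF assms, of x b y] by (simp add: iff)
  qed
  moreover have "ran (erase R c) = ran c - R" using iff by (auto simp: ran_def)
  moreover have "dom (erase R c) \<subseteq> dom c" using iff by blast
  ultimately show ?thesis using assms by (auto simp: valid_def intro: finite_subset)
qed

text \<open>After the balls in \<open>bs\<close> have moved, \<open>m\<close> are the balls beyond the original rightmost run \<open>r\<close>.\<close>

definition frontier :: "nat \<Rightarrow> nat list \<Rightarrow> nat list \<Rightarrow> configuration \<Rightarrow> nat list \<Rightarrow> bool" where
  "frontier p r bs c m \<longleftrightarrow> sorted_wrt (<) m \<and> set m \<subseteq> set bs \<and>
     (\<forall>i. c (p + length r + i) = (if i < length m then Some (m ! i) else None)) \<and>
     (\<forall>i < length r. if r ! i \<in> set bs then r ! i \<in> set m else c (p + i) = Some (r ! i))"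

context
  fixes p :: nat and r :: "nat list" and P :: "(nat \<times> nat list) list" and bs :: "nat list"
  assumes arr: "arrangement ((p, r) # P)"
    and val: "valid (set bs) (place_runs ((p, r) # P))"
    and bs: "sorted_wrt (<) bs"
begin

lemma run_sorted: "r \<noteq> []" "sorted_wrt (<) r" "i < j \<Longrightarrow> j < length r \<Longrightarrow> r ! i < r ! j"
  using arr sorted_wrt_nth_less[of "(<)" r i j] by auto

lemma run_label: "i < length r \<Longrightarrow> r ! i \<in> set bs"
  using valid_label[OF val, of "p + i"] by (simp add: place_runs.simps)

lemma valid_prefix: "bs = bs1 @ bs2 \<Longrightarrow> valid (set bs) (fold move_ball bs1 (place_runs ((p, r) # P)))"
  by (rule valid_fold_move_ball[OF val]) auto

text \<open>The balls move in increasing order, so a newcomer beyond the end of \<open>r\<close>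
  exceeds those already there. It also lands directly behind them, which keeps the block increasing
  and free of gaps.\<close>

lemma frontier_prefix:
  "bs = bs1 @ bs2 \<Longrightarrow> \<exists>m. frontier p r bs1 (fold move_ball bs1 (place_runs ((p, r) # P))) m"
proof (induction bs1 arbitrary: bs2 rule: rev_induct)
  case Nil
  have "place_runs ((p, r) # P) (p + length r + i) = None" for i
    using place_runs_beyond[OF arr, of "p + length r + i"] by (simp add: place_runs.simps)
  then show ?case by (intro exI[of _ "[]"]) (simp add: frontier_def place_runs.simps)
next
  case (snoc b bs1)
  let ?E = "p + length r"
  define c where "c = fold move_ball bs1 (place_runs ((p, r) # P))"
  have bs_eq: "bs = bs1 @ b # bs2" using snoc.prems by simp
  then obtain m where "frontier p r bs1 c m" using snoc.IH[of "b # bs2"] unfolding c_def by blast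
  then have m: "sorted_wrt (<) m" "set m \<subseteq> set bs1"
    "\<And>i. c (?E + i) = (if i < length m then Some (m ! i) else None)"
    "\<And>i. i < length r \<Longrightarrow> r ! i \<in> set bs1 \<Longrightarrow> r ! i \<in> set m"
    "\<And>i. i < length r \<Longrightarrow> r ! i \<notin> set bs1 \<Longrightarrow> c (p + i) = Some (r ! i)"
    unfolding frontier_def by (auto split: if_splits)
  have below: "x < b" if "x \<in> set bs1" for x using that bs bs_eq by (auto simp: sorted_wrt_append)
  have valc: "valid (set bs) c" unfolding c_def by (rule valid_prefix[OF bs_eq])
  obtain s q where sq: "c s = Some b" "s < q" "c q = None" "\<And>j. s < j \<Longrightarrow> j < q \<Longrightarrow> c j \<noteq> None"
    "move_ball b c = c(s := None, q := Some b)"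
    using valid_move_ball[OF valc, of b] bs_eq by (metis in_set_conv_decomp)
  have s: "s < ?E"
  proof (rule ccontr)
    assume "\<not> s < ?E"
    then obtain i where "s = ?E + i" by (metis le_Suc_ex not_less)
    then have "b \<in> set m" using m(3)[of i] sq(1) by (auto split: if_splits)
    then show False using m(2) below by blast
  qed
  have unmoved: "move_ball b c (p + i) = Some (r ! i)"
    if "i < length r" "r ! i \<notin> set (bs1 @ [b])" for i
  proof -
    have "c (p + i) = Some (r ! i)" "r ! i \<noteq> b" using that m(5) by auto
    then show ?thesis using sq by auto
  qed
  have fold: "fold move_ball (bs1 @ [b]) (place_runs ((p, r) # P)) = move_ball b c"
    by (simp add: c_def)
  show ?case
  proof (cases "q < ?E")
    case True
    \<comment> \<open>When a ball of \<open>r\<close> moves, the boxes from it to the end of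
      \<open>r\<close> still hold larger balls of \<open>r\<close>, so it cannot land before that
      end.\<close>
    have "b \<noteq> r ! i" if i: "i < length r" for i
    proof
      assume b: "b = r ! i"
      have later: "r ! j \<notin> set bs1" if "i \<le> j" "j < length r" for j
        using below run_sorted(3)[of i j] that b by (cases "i = j") force+
      then have "s = p + i" using m(5)[of i] i sq(1) b valid_unique[OF valc, of s b "p + i"] by simp
      then have "c (p + (q - p)) = Some (r ! (q - p))" using True sq(2) by (intro m(5) later) auto
      then show False using sq \<open>s = p + i\<close> by simp
    qed
    then have "frontier p r (bs1 @ [b]) (move_ball b c) m"
      using m s True sq(5) unmoved unfolding frontier_def by auto
    then show ?thesis unfolding fold by blast
  next
    case False
    \<comment> \<open>The occupied boxes from \<open>?E\<close> on are exactly those of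
      \<open>m\<close>, hence the first empty one comes right after it.\<close>
    have q: "q = ?E + length m"
    proof -
      obtain i where i: "q = ?E + i" using False by (metis le_Suc_ex not_less)
      then have "length m \<le> i" using m(3)[of i] sq(3) by (auto split: if_splits)
      moreover have "\<not> length m < i" using sq(4)[of "?E + length m"] m(3)[of "length m"] s i by auto
      ultimately show ?thesis using i by simp
    qed
    have "sorted_wrt (<) (m @ [b])" using m(1,2) below by (auto simp: sorted_wrt_append)
    moreover have "move_ball b c (?E + i) = (if i < length (m @ [b]) then Some ((m @ [b]) ! i) else None)" for i
      using m(3)[of i] s unfolding sq(5) q by (auto simp: nth_append less_Suc_eq)
    ultimately have "frontier p r (bs1 @ [b]) (move_ball b c) (m @ [b])"
      using m(2,4) unmoved unfolding frontier_def by auto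
    then show ?thesis unfolding fold by blast
  qed
qed

text \<open>By \<open>final\<close>, a ball outside \<open>r\<close> lands before the end of
  \<open>r\<close>. No ball of \<open>r\<close> lies on its way: those that have moved are beyond
  the end, and one still waiting would have full boxes behind it up to that end.\<close>

lemma erase_prefix:
  assumes final: "\<And>q b. p + length r \<le> q \<Longrightarrow>
      fold move_ball bs (place_runs ((p, r) # P)) q = Some b \<Longrightarrow> b \<in> set r"
  shows "bs = bs1 @ bs2 \<Longrightarrow> erase (set r) (fold move_ball bs1 (place_runs ((p, r) # P)))
    = fold move_ball (filter (\<lambda>b. b \<notin> set r) bs1) (place_runs P)"
proof (induction bs1 arbitrary: bs2 rule: rev_induct)
  case Nil
  then show ?case by (simp add: erase_place_runs[OF arr val])
next
  case (snoc b bs1)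
  let ?E = "p + length r"
  define c where "c = fold move_ball bs1 (place_runs ((p, r) # P))"
  have bs_eq: "bs = bs1 @ b # bs2" using snoc.prems by simp
  have IH: "erase (set r) c = fold move_ball (filter (\<lambda>b. b \<notin> set r) bs1) (place_runs P)"
    using snoc.IH[of "b # bs2"] bs_eq unfolding c_def by blast
  obtain m where "frontier p r bs1 c m" using frontier_prefix[OF bs_eq] unfolding c_def by blast
  then have m: "set m \<subseteq> set bs1"
    "\<And>i. c (?E + i) = (if i < length m then Some (m ! i) else None)"
    "\<And>i. i < length r \<Longrightarrow> r ! i \<in> set bs1 \<Longrightarrow> r ! i \<in> set m"
    "\<And>i. i < length r \<Longrightarrow> r ! i \<notin> set bs1 \<Longrightarrow> c (p + i) = Some (r ! i)"
    unfolding frontier_def by (auto split: if_splits)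
  have valc: "valid (set bs) c" unfolding c_def by (rule valid_prefix[OF bs_eq])
  obtain s q where sq: "c s = Some b" "s < q" "c q = None" "\<And>j. s < j \<Longrightarrow> j < q \<Longrightarrow> c j \<noteq> None"
    "move_ball b c = c(s := None, q := Some b)" "valid (set bs) (move_ball b c)"
    using valid_move_ball[OF valc, of b] bs_eq by (metis in_set_conv_decomp)
  have s_unique: "c j = Some b \<longleftrightarrow> j = s" for j using valid_unique[OF valc] sq(1) by blast
  have fold: "fold move_ball (bs1 @ [b]) (place_runs ((p, r) # P)) = move_ball b c"
    by (simp add: c_def)
  show ?case
  proof (cases "b \<in> set r")
    case True
    then have "erase (set r) (move_ball b c) = erase (set r) c"
      using sq unfolding erase_def by auto
    then show ?thesis using True IH fold by simp
  next
    case False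
    have "fold move_ball bs (place_runs ((p, r) # P)) = fold move_ball bs2 (move_ball b c)"
      by (simp add: bs_eq c_def)
    moreover have "fold move_ball bs2 (move_ball b c) q = Some b"
      using sq bs bs_eq by (intro fold_move_ball_other[OF sq(6)]) (auto simp: sorted_wrt_append)
    ultimately have q: "q < ?E" using final[of q b] False by (metis not_less)
    have "move_ball b (erase (set r) c) = (erase (set r) c)(s := None, q := Some b)"
    proof (rule move_ball_eq)
      show "erase (set r) c j = Some b \<longleftrightarrow> j = s" for j
        using s_unique[of j] False by (auto simp: erase_def)
      fix j assume j: "s < j" "j < q"
      have "c j \<noteq> Some (r ! i)" if i: "i < length r" for i
      proof
        assume cj: "c j = Some (r ! i)"
        show False
        proof (cases "r ! i \<in> set bs1")
          case True
          then obtain l where "l < length m" "m ! l = r ! i" using m(3)[OF i] by (metis in_set_conv_nth)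
          then have "j = ?E + l" using m(2)[of l] cj valid_unique[OF valc, of j "r ! i" "?E + l"] by simp
          then show False using j q by simp
        next
          case i_unmoved: False
          then have "j = p + i" using m(4)[OF i] cj valid_unique[OF valc, of j "r ! i" "p + i"] by simp
          have i2: "r ! i \<in> set (b # bs2)" using run_label[OF i] i_unmoved bs_eq by auto
          have "r ! (q - p) \<notin> set bs1"
            using run_sorted(3)[of i "q - p"] i2 bs bs_eq j q \<open>j = p + i\<close>
            by (force simp: sorted_wrt_append)
          then have "c (p + (q - p)) = Some (r ! (q - p))" using j q \<open>j = p + i\<close> by (intro m(4)) auto
          then show False using sq(3) j \<open>j = p + i\<close> by simp
        qed
      qed
      then have "c j \<notin> Some ` set r" by (metis imageE in_set_conv_nth)
      then show "erase (set r) c j \<noteq> None" using sq(4)[OF j] by (simp add: erase_def)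
    qed (use sq in \<open>auto simp: erase_def\<close>)
    also have "\<dots> = erase (set r) (move_ball b c)"
      using sq False unfolding erase_def by (auto simp: fun_eq_iff)
    finally show ?thesis using IH fold False by simp
  qed
qed

text \<open>Equal length is the situation once the rightmost run has stopped growing. The clause on
  the boxes just left by \<open>r\<close> is the source of the spacing condition in
  \<open>well_spaced\<close>.\<close>

lemma BBS_last_run:
  assumes Q: "arrangement Q" "place_runs Q = fold move_ball bs (place_runs ((p, r) # P))"
  obtains p1 r1 P1 where "Q = (p1, r1) # P1" "set r \<subseteq> set r1"
    "length r1 = length r \<longrightarrow> p1 = p + length r \<and> r1 = r \<and>
       place_runs P1 = fold move_ball (filter (\<lambda>b. b \<notin> set r) bs) (place_runs P) \<and>
       (\<forall>i < length r. \<forall>b. place_runs P1 (p + i) = Some b \<longrightarrow> r ! i < b)"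
proof -
  let ?E = "p + length r" and ?c = "fold move_ball bs (place_runs ((p, r) # P))"
  have valc: "valid (set bs) ?c" using valid_prefix[of bs "[]"] by simp
  obtain m where "frontier p r bs ?c m" using frontier_prefix[of bs "[]"] by auto
  then have m: "sorted_wrt (<) m"
    "\<And>i. ?c (?E + i) = (if i < length m then Some (m ! i) else None)"
    "\<And>i. i < length r \<Longrightarrow> r ! i \<in> set m"
    unfolding frontier_def using run_label by (auto split: if_splits)
  have rm: "set r \<subseteq> set m" using m(3) by (auto simp: in_set_conv_nth)
  then have "m \<noteq> []" using run_sorted(1) by auto
  \<comment> \<open>This block lies in a single run. Nothing lies to the right of the block, so that
    run is the rightmost one, though it may start before \<open>?E\<close>.\<close>
  then have "increasing_block (place_runs Q) ?E m"
    unfolding increasing_block_def Q(2) using m by simp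
  then obtain p0 r0 where 0: "(p0, r0) \<in> set Q" "p0 \<le> ?E" "?E + length m \<le> p0 + length r0"
    using increasing_block_place_runs[OF Q(1)] by blast
  then obtain p1 r1 P1 where Q1: "Q = (p1, r1) # P1" by (cases Q) auto
  have r1: "r1 \<noteq> []" "sorted_wrt (<) r1" using Q(1) Q1 by auto
  have at1: "?c (p1 + i) = Some (r1 ! i)" if "i < length r1" for i
    using that place_runs_mem[OF Q(1), of p1 r1 i] Q1 Q(2) by simp
  have end1: "p1 + i < ?E + length m" if i: "i < length r1" for i
  proof (rule ccontr)
    assume "\<not> ?thesis"
    then obtain j where j: "p1 + i = ?E + length m + j" by (meson le_Suc_ex not_less)
    then show False using at1[OF i] m(2)[of "length m + j"] by (simp add: add.assoc)
  qed
  have eq0: "p0 = p1" "r0 = r1"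
  proof -
    have "(p0, r0) = (p1, r1)"
    proof (rule ccontr)
      assume "(p0, r0) \<noteq> (p1, r1)"
      then have "p0 + length r0 \<le> p1" using arrangement_before[of p1 r1 P1 p0 r0] 0 Q Q1 by auto
      then show False using 0 end1[of 0] r1 by auto
    qed
    then show "p0 = p1" "r0 = r1" by auto
  qed
  have "p1 + length r1 \<le> ?E + length m" using end1[of "length r1 - 1"] r1 by (cases r1) auto
  then have ends: "p1 + length r1 = ?E + length m" "p1 \<le> ?E" using 0 eq0 by auto
  have mr1: "set m \<subseteq> set r1"
  proof
    fix x assume "x \<in> set m"
    then obtain i where i: "i < length m" "m ! i = x" by (auto simp: in_set_conv_nth)
    then have "?c (p1 + (?E + i - p1)) = Some (r1 ! (?E + i - p1))" using ends by (intro at1) auto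
    then show "x \<in> set r1" using m(2)[of i] i ends by (auto simp: add.assoc)
  qed
  show ?thesis
  proof (rule that[OF Q1 _ impI])
    show "set r \<subseteq> set r1" using rm mr1 by blast
    assume len: "length r1 = length r"
    have dist: "distinct r" "distinct r1" "distinct m"
      using run_sorted(2) r1(2) m(1) by (auto simp: strict_sorted_iff)
    then have "card (set r) = card (set r1)" using len by (simp add: distinct_card)
    then have "set r = set r1" using rm mr1 by (intro card_subset_eq) auto
    then have eq: "r1 = r" "m = r" using rm mr1 run_sorted(2) r1(2) m(1)
      by (auto intro!: strict_sorted_equal)
    then have p1: "p1 = ?E" using ends by simp
    have final: "b \<in> set r" if b: "?E \<le> q" "?c q = Some b" for q b
    proof -
      obtain i where "q = ?E + i" using b(1) le_Suc_ex by blast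
      then show ?thesis using m(2)[of i] b(2) eq by (auto split: if_splits)
    qed
    have "erase (set r) ?c = fold move_ball (filter (\<lambda>b. b \<notin> set r) bs) (place_runs P)"
      by (rule erase_prefix[of bs "[]"]) (use final in auto)
    then have rest: "place_runs P1 = fold move_ball (filter (\<lambda>b. b \<notin> set r) bs) (place_runs P)"
      using erase_place_runs[of p1 r1 P1 "set bs"] Q Q1 valc eq by simp
    \<comment> \<open>A smaller ball makes its only move before \<open>r ! i\<close> leaves, when
      box \<open>p + i\<close> is still taken, so it cannot end up there.\<close>
    have "r ! i < b" if i: "i < length r" and b: "place_runs P1 (p + i) = Some b" for i b
    proof (rule ccontr)
      assume "\<not> r ! i < b"
      have vr: "valid (set bs - set r) (place_runs P1)"
        using valid_erase[OF valc, of "set r"] erase_place_runs[of p1 r1 P1 "set bs"] Q Q1 valc eq by simp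
      then have bS: "b \<in> set bs" "b \<notin> set r" using valid_label b by blast+
      then have lt: "b < r ! i" using i \<open>\<not> r ! i < b\<close> nth_mem[OF i] by (cases "b = r ! i") auto
      obtain bs1 bs2 where "bs = bs1 @ b # bs2" using bS(1) by (meson split_list)
      then have bs_eq: "bs = (bs1 @ [b]) @ bs2" by simp
      let ?d = "fold move_ball (bs1 @ [b]) (place_runs ((p, r) # P))"
      have vd: "valid (set bs) ?d" using valid_prefix[OF bs_eq] .
      obtain j where j: "?d j = Some b" using vd bS by (auto simp: valid_def ran_def)
      have "?c = fold move_ball bs2 ?d" by (simp add: bs_eq)
      moreover have "b \<notin> set bs2" using bs bs_eq by (auto simp: sorted_wrt_append)
      ultimately have "?c j = Some b" using fold_move_ball_other[OF vd _ _ j, of bs2] bs_eq by auto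
      moreover have "?c (p + i) = Some b"
        unfolding Q(2)[symmetric] using b Q1 p1 i by (simp add: place_runs.simps)
      ultimately have "j = p + i" using valid_unique[OF valc] by blast
      obtain m' where "frontier p r (bs1 @ [b]) ?d m'" using frontier_prefix[OF bs_eq] by blast
      moreover have "r ! i \<notin> set (bs1 @ [b])" using bs bs_eq lt by (auto simp: sorted_wrt_append)
      ultimately have "?d (p + i) = Some (r ! i)" using i unfolding frontier_def by auto
      then show False using j \<open>j = p + i\<close> lt by simp
    qed
    then show "p1 = ?E \<and> r1 = r \<and>
       place_runs P1 = fold move_ball (filter (\<lambda>b. b \<notin> set r) bs) (place_runs P) \<and>
       (\<forall>i < length r. \<forall>b. place_runs P1 (p + i) = Some b \<longrightarrow> r ! i < b)"
      using p1 eq rest by blast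
  qed
qed

end

section \<open>Steady states\<close>

definition advance :: "nat \<Rightarrow> (nat \<times> nat list) list \<Rightarrow> (nat \<times> nat list) list" where
  "advance t P = map (\<lambda>(p, r). (p + t * length r, r)) P"

lemma advance_simps [simp]:
  "advance t [] = []" "advance t ((p, r) # P) = (p + t * length r, r) # advance t P"
  "advance 0 P = P"
  by (simp_all add: advance_def case_prod_unfold)

lemma valid_funpow: "valid (set bs) c \<Longrightarrow> valid (set bs) ((fold move_ball bs ^^ t) c)"
  by (induction t) (simp_all add: valid_fold_move_ball)

lemma eventually_solitons:
  assumes "sorted_wrt (<) bs" "valid (set bs) c"
  shows "\<exists>T P. well_spaced P \<and>
    (\<forall>t. arrangement (advance t P) \<and> (fold move_ball bs ^^ (T + t)) c = place_runs (advance t P))"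
  using assms
proof (induction "length bs" arbitrary: bs c rule: less_induct)
  case less
  define s where "s t = (fold move_ball bs ^^ t) c" for t
  have s_Suc: "s (Suc t) = fold move_ball bs (s t)" for t by (simp add: s_def)
  have val: "valid (set bs) (s t)" for t using valid_funpow[OF less.prems(2)] by (simp add: s_def)
  show ?case
  proof (cases "bs = []")
    case True
    then have "ran c = {}" using less.prems(2) by (simp add: valid_def)
    then have "c = place_runs []" by (intro ext) (metis empty_iff not_Some_eq place_runs.simps(1) ranI)
    moreover have "(fold move_ball bs ^^ t) c = c" for t using True by (induction t) auto
    ultimately show ?thesis by (intro exI[of _ 0] exI[of _ "[]"]) simp
  next
    case False
    have "\<exists>Q. arrangement Q \<and> place_runs Q = s t \<and> Q \<noteq> []" for t
    proof -
      obtain Q where Q: "arrangement Q" "place_runs Q = s t"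
        using arrangement_exists[of "s t"] val[of t] unfolding valid_def by blast
      have "ran (s t) \<noteq> {}" using val[of t] False by (simp add: valid_def)
      then have "Q \<noteq> []" unfolding Q(2)[symmetric] by (auto simp: ran_def)
      then show ?thesis using Q by blast
    qed
    then obtain A where A: "\<And>t. arrangement (A t)" "\<And>t. place_runs (A t) = s t" "\<And>t. A t \<noteq> []"
      by metis
    define p r P where "p t = fst (hd (A t))" and "r t = snd (hd (A t))" and "P t = tl (A t)" for t
    have "(p t, r t) # P t = A t" for t using A(3)[of t] by (simp add: p_def r_def P_def)
    then have Q: "arrangement ((p t, r t) # P t)" "place_runs ((p t, r t) # P t) = s t" for t
      using A by simp_all
    have val': "valid (set bs) (place_runs ((p t, r t) # P t))" for t using val Q(2) by simp
    have step: "set (r t) \<subseteq> set (r (Suc t))"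
      "length (r (Suc t)) = length (r t) \<Longrightarrow> p (Suc t) = p t + length (r t) \<and> r (Suc t) = r t \<and>
       place_runs (P (Suc t)) = fold move_ball (filter (\<lambda>b. b \<notin> set (r t)) bs) (place_runs (P t)) \<and>
       (\<forall>i < length (r t). \<forall>b. place_runs (P (Suc t)) (p t + i) = Some b \<longrightarrow> r t ! i < b)" for t
    proof -
      have "place_runs ((p (Suc t), r (Suc t)) # P (Suc t)) = fold move_ball bs (place_runs ((p t, r t) # P t))"
        by (simp only: Q(2) s_Suc)
      from BBS_last_run[OF Q(1) val' less.prems(1) Q(1) this]
      obtain p1 r1 P1 where *: "(p (Suc t), r (Suc t)) # P (Suc t) = (p1, r1) # P1" "set (r t) \<subseteq> set r1"
        "length r1 = length (r t) \<longrightarrow> p1 = p t + length (r t) \<and> r1 = r t \<and>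
         place_runs P1 = fold move_ball (filter (\<lambda>b. b \<notin> set (r t)) bs) (place_runs (P t)) \<and>
         (\<forall>i < length (r t). \<forall>b. place_runs P1 (p t + i) = Some b \<longrightarrow> r t ! i < b)" .
      have eq: "p1 = p (Suc t)" "r1 = r (Suc t)" "P1 = P (Suc t)" using *(1) by simp_all
      show "set (r t) \<subseteq> set (r (Suc t))" using *(2) unfolding eq .
      show "p (Suc t) = p t + length (r t) \<and> r (Suc t) = r t \<and>
       place_runs (P (Suc t)) = fold move_ball (filter (\<lambda>b. b \<notin> set (r t)) bs) (place_runs (P t)) \<and>
       (\<forall>i < length (r t). \<forall>b. place_runs (P (Suc t)) (p t + i) = Some b \<longrightarrow> r t ! i < b)"
        if "length (r (Suc t)) = length (r t)" using *(3) that unfolding eq by (rule mp)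
    qed
    have r: "r t \<noteq> []" "distinct (r t)" "sorted_wrt (<) (r t)" for t
      using Q(1)[of t] by (auto simp: strict_sorted_iff)
    have mono: "length (r t) \<le> length (r t')" if "t \<le> t'" for t t'
    proof (rule lift_Suc_mono_le[OF _ that])
      show "length (r t) \<le> length (r (Suc t))" for t
        using card_mono[OF _ step(1)[of t]] r(2) by (simp add: distinct_card)
    qed
    have sub: "set (r t) \<subseteq> set bs" for t
    proof
      fix x assume "x \<in> set (r t)"
      then obtain i where "i < length (r t)" "r t ! i = x" by (auto simp: in_set_conv_nth)
      then have "s t (p t + i) = Some x" using place_runs_mem[OF Q(1)[of t]] Q(2) by auto
      then show "x \<in> set bs" using valid_label[OF val] by blast
    qed
    have "length (r t) \<le> length bs" for t
      using card_mono[OF _ sub[of t]] r(2) card_length[of bs] by (simp add: distinct_card)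
    \<comment> \<open>The lengths are bounded by the number of balls; being weakly increasing, they
      are constant from a time of greatest length on.\<close>
    then have "\<exists>T. True \<and> (\<forall>t. True \<longrightarrow> length (r t) \<le> length (r T))"
      by (intro ex_has_greatest_nat[of "\<lambda>_. True" 0 "\<lambda>t. length (r t)" "Suc (length bs)"])
        (simp_all add: less_Suc_eq_le)
    then obtain T0 where T0: "\<And>t. length (r t) \<le> length (r T0)" by blast
    have const: "length (r (T0 + t)) = length (r T0)" for t using mono[of T0 "T0 + t"] T0 by (simp add: le_antisym)
    define R where "R = r T0"
    define bs' where "bs' = filter (\<lambda>b. b \<notin> set R) bs"
    have track: "r (T0 + t) = R \<and> p (T0 + t) = p T0 + t * length R \<and>
        place_runs (P (T0 + t)) = (fold move_ball bs' ^^ t) (place_runs (P T0))" for t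
    proof (induction t)
      case (Suc t)
      then show ?case using step(2)[of "T0 + t"] const[of t] const[of "Suc t"] by (simp add: bs'_def)
    qed (simp add: R_def)
    obtain x where "x \<in> set R" using hd_in_set[OF r(1)[of T0]] unfolding R_def by blast
    then have "length bs' < length bs" unfolding bs'_def
      using sub[of T0] by (intro length_filter_less[of x]) (auto simp: R_def)
    moreover have "sorted_wrt (<) bs'" unfolding bs'_def using less.prems(1) by (rule sorted_wrt_filter)
    moreover have "valid (set bs') (place_runs (P T0))"
    proof -
      have "valid (set bs - set R) (place_runs (P T0))"
        using valid_erase[OF val', of "set R" T0] erase_place_runs[OF Q(1) val'] by (simp add: R_def)
      moreover have "set bs' = set bs - set R" by (auto simp: bs'_def)
      ultimately show ?thesis by simp
    qed
    ultimately obtain T1 Q1 where Q1: "well_spaced Q1" "\<And>t. arrangement (advance t Q1)"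
      "\<And>t. (fold move_ball bs' ^^ (T1 + t)) (place_runs (P T0)) = place_runs (advance t Q1)"
      using less.hyps by blast
    have rest: "P (T0 + (T1 + t)) = advance t Q1" for t
    proof (rule arrangement_unique)
      show "arrangement (P (T0 + (T1 + t)))" using Q(1) by (metis arrangement.simps(2))
    qed (use Q1 track in auto)
    let ?p = "p (T0 + T1)" and ?T = "T0 + T1"
    have p_adv: "p (?T + t) = ?p + t * length R" for t
      using track[of "T1 + t"] track[of T1] by (simp add: add.assoc algebra_simps)
    have full: "(p (?T + t), r (?T + t)) # P (?T + t) = advance t ((?p, R) # Q1)" for t
      using track[of "T1 + t"] rest[of t] p_adv[of t] by (simp add: add.assoc)
    have arr: "arrangement (advance t ((?p, R) # Q1))" for t using Q(1) full by metis
    have "well_spaced ((?p, R) # Q1)"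
    proof (cases Q1)
      case (Cons a Q2)
      obtain p' r' where a: "a = (p', r')" by (cases a)
      have "length r' \<le> length R"
      proof (rule ccontr)
        assume "\<not> ?thesis"
        \<comment> \<open>A longer run on the left would gain at least one box per move. The
          distance is at most \<open>?p\<close>, so it would have overtaken \<open>R\<close> after
          \<open>Suc ?p\<close> moves.\<close>
        then have "Suc (length R) \<le> length r'" by simp
        then have "Suc ?p * Suc (length R) \<le> Suc ?p * length r'" by (rule mult_le_mono2)
        moreover have "p' + Suc ?p * length r' + length r' \<le> ?p + Suc ?p * length R"
          using arr[of "Suc ?p"] by (simp add: Cons a)
        ultimately show False by simp
      qed
      moreover have "R ! i < r' ! j"
        if "i < length R" "j < length r'" "?p + i = p' + length r' + j" for i j
      proof -
        \<comment> \<open>One move later the left run starts at \<open>p' + length r'\<close>, so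
          ball \<open>r' ! j\<close> occupies the box \<open>?p + i\<close> just left by
          \<open>R ! i\<close>.\<close>
        have "place_runs (P (Suc ?T)) (p' + length r' + j) = Some (r' ! j)"
          using rest[of 1] place_runs_mem[OF Q1(2)[of 1], of "p' + length r'" r' j] that
          by (simp add: Cons a)
        then show ?thesis using step(2)[of ?T] const[of T1] const[of "Suc T1"] track[of T1] that
          by simp
      qed
      ultimately show ?thesis using Q1(1) by (simp add: Cons a)
    qed simp
    moreover have "(fold move_ball bs ^^ (?T + t)) c = place_runs (advance t ((?p, R) # Q1))" for t
      using Q(2)[of "?T + t"] full[of t] by (simp add: s_def)
    ultimately show ?thesis using arr by blast
  qed
qed

section \<open>The soliton decomposition at the first steady time\<close>

lemma well_spaced_sorted: "well_spaced P \<Longrightarrow> sorted_wrt (\<ge>) (map (\<lambda>x. length (snd x)) P)"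
proof (induction P)
  case (Cons a P)
  obtain p r where a: "a = (p, r)" by (cases a)
  show ?case
  proof (cases P)
    case (Cons b P')
    obtain p' r' where b: "b = (p', r')" by (cases b)
    have "sorted_wrt (\<ge>) (map (\<lambda>x. length (snd x)) P)" "length r' \<le> length r"
      using Cons.IH Cons.prems by (auto simp: a b Cons)
    then show ?thesis by (auto simp: a b Cons intro: order_trans)
  qed simp
qed simp

lemma distinct_runs:
  assumes "arrangement P" "valid S (place_runs P)"
  shows "distinct (map snd P)"
proof -
  have "distinct (map fst P)" unfolding map_fst_arrangement[OF assms(1)] by simp
  then have "distinct P" by (simp add: distinct_map)
  moreover have "inj_on snd (set P)"
  proof (rule inj_onI)
    fix x y assume *: "x \<in> set P" "y \<in> set P" "snd x = snd y"
    obtain p p' r where xy: "x = (p, r)" "y = (p', r)" using *(3) by (metis prod.collapse)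
    then have "r \<noteq> []" using arrangement_mem[OF assms(1)] * by blast
    then have "place_runs P p = Some (r ! 0)" "place_runs P p' = Some (r ! 0)"
      using place_runs_mem[OF assms(1), of _ r 0] * xy by auto
    then show "x = y" using valid_unique[OF assms(2)] xy by blast
  qed
  ultimately show ?thesis by (simp add: distinct_map)
qed

lemma SD_properties:
  assumes "w \<in> permutations_of_set {1..n}"
  shows "length (SD w) = word_des 1 w"
    and "k > 0 \<Longrightarrow> (\<Sum>x\<leftarrow>tableau_shape (SD w). min k x) = word_des k w"
    and "sorted_wrt (\<ge>) (tableau_shape (SD w))" "0 \<notin> set (tableau_shape (SD w))"
proof -
  have w: "set w = {1..n}" "distinct w" "length w = n"
    using assms by (auto simp: permutations_of_set_def distinct_card[symmetric])
  define bs where "bs = [1..<Suc n]"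
  have bs: "sorted_wrt (<) bs" "set bs = {1..n}" unfolding bs_def
    by (simp_all add: atLeastLessThanSuc_atLeastAtMost del: upt_Suc)
  have move: "BBS_move n = fold move_ball bs" by (simp add: BBS_move_def bs_def fun_eq_iff)
  let ?c = "initial_configuration w"
  define s where "s t = (fold move_ball bs ^^ t) ?c" for t
  have state: "BBS_state w t = s t" for t by (simp add: BBS_state_def w(3) move s_def)
  have s_add: "(BBS_move n ^^ t) (s t') = s (t' + t)" for t t'
    by (simp add: move s_def funpow_add add.commute[of t'])
  have "valid (set bs) ?c"
  proof -
    have "ran ?c = set w" by (auto simp: initial_configuration_def ran_def set_conv_nth)
    moreover have "dom ?c = {..<length w}" by (auto simp: initial_configuration_def split: if_splits)
    moreover have "inj_on ?c {..<length w}"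
      using w(2) by (auto simp: inj_on_def initial_configuration_def nth_eq_iff_index_eq)
    ultimately show ?thesis using w(1) bs(2) by (simp add: valid_def)
  qed
  then have val: "valid (set bs) (s t)" for t unfolding s_def by (rule valid_funpow)
  have des: "config_des k (s t) = word_des k w" if "k > 0" for k t
  proof (induction t)
    case (Suc t)
    then show ?case using config_des_BBS[OF val[of t] bs(1) that] by (simp add: s_def)
  qed (simp add: s_def config_des_initial[OF that])
  obtain T P where P: "well_spaced P" "\<And>t. arrangement (advance t P)" "\<And>t. s (T + t) = place_runs (advance t P)"
    using eventually_solitons[OF bs(1) val[of 0]] unfolding s_def by auto
  have P0: "arrangement P" "s T = place_runs P" using P(2,3)[of 0] by simp_all
  \<comment> \<open>This makes the \<open>LEAST\<close> in \<open>SD\<close> meaningful and places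
    the first steady time at or before \<open>T\<close>.\<close>
  have steady: "steady_state n (s T)"
    unfolding steady_state_def
  proof (intro conjI allI impI)
    fix p r assume "increasing_run (s T) p r"
    then have mem: "(p, r) \<in> set P" using increasing_run_place_runs[OF P0(1)] P0(2) by simp
    show "soliton n (s T) r"
      unfolding soliton_def
    proof
      fix t
      have "(p + t * length r, r) \<in> set (advance t P)" using mem by (force simp: advance_def)
      then show "\<exists>p. increasing_run ((BBS_move n ^^ t) (s T)) p r"
        unfolding s_add P(3) using increasing_run_place_runs[OF P(2)] by blast
    qed
  next
    show "sorted_wrt (\<ge>) (map length (runs_from_right (s T)))"
      using well_spaced_sorted[OF P(1)] runs_from_right_place_runs[OF P0(1)] P0(2)
      by (simp add: comp_def)
  qed
  define t0 where "t0 = (LEAST t. steady_state n (s t))"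
  have t0: "steady_state n (s t0)" "t0 \<le> T"
    unfolding t0_def using steady by (auto intro: LeastI Least_le)
  obtain Q where Q: "arrangement Q" "place_runs Q = s t0"
    using arrangement_exists[of "s t0"] val[of t0] by (auto simp: valid_def)
  have SD: "SD w = map snd Q"
    using runs_from_right_place_runs[OF Q(1)] by (simp add: SD_def state w(3) t0_def[symmetric] Q(2))
  have len: "length Q = word_des 1 w" "length P = word_des 1 w"
    using config_des_1_place_runs[OF Q(1)] config_des_1_place_runs[OF P0(1)] des[of 1 t0] des[of 1 T] Q(2) P0(2)
    by simp_all
  show "length (SD w) = word_des 1 w" using len SD by simp
  \<comment> \<open>Runs at time \<open>t0\<close> are solitons and hence still runs at time
    \<open>T\<close>. Both times have \<open>word_des 1 w\<close> runs, so none is missing.\<close>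
  have sub: "set (map snd Q) \<subseteq> set (map snd P)"
  proof
    fix r assume "r \<in> set (map snd Q)"
    then obtain p where "(p, r) \<in> set Q" by auto
    then have "increasing_run (s t0) p r" using increasing_run_place_runs[OF Q(1)] Q(2) by simp
    then have "soliton n (s t0) r" using t0(1) unfolding steady_state_def by blast
    then obtain p' where "increasing_run ((BBS_move n ^^ (T - t0)) (s t0)) p' r"
      unfolding soliton_def by blast
    then have "increasing_run (place_runs P) p' r" using t0(2) P0(2) by (simp add: s_add)
    then show "r \<in> set (map snd P)" using increasing_run_place_runs[OF P0(1)] by force
  qed
  have dist: "distinct (map snd Q)" "distinct (map snd P)"
    using distinct_runs[OF Q(1), of "set bs"] distinct_runs[OF P0(1), of "set bs"]
      val[of t0] val[of T] Q(2) P0(2) by simp_all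
  have "card (set (map snd Q)) = card (set (map snd P))"
    using distinct_card[OF dist(1)] distinct_card[OF dist(2)] len by simp
  then have "set (map snd Q) = set (map snd P)" using sub by (intro card_subset_eq) auto
  then have "mset (map snd Q) = mset (map snd P)" using dist set_eq_iff_mset_eq_distinct by blast
  \<comment> \<open>The order of the runs at the two times is not compared: the sums need only the
    multiset of lengths, and their order at \<open>t0\<close> comes from steadiness.\<close>
  then have "mset (map length (map snd Q)) = mset (map length (map snd P))"
    by (simp only: mset_map)
  then have "mset (map (min k) (tableau_shape (SD w))) = mset (map (min k) (map length (map snd P)))"
    unfolding tableau_shape_def SD by (simp only: mset_map)
  then have "(\<Sum>x\<leftarrow>tableau_shape (SD w). min k x) = (\<Sum>x\<leftarrow>map length (map snd P). min k x)"
    by (metis sum_mset_sum_list)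
  also have "\<dots> = (\<Sum>(p, r)\<leftarrow>P. min k (length r))"
    by (simp add: comp_def case_prod_unfold)
  finally show "k > 0 \<Longrightarrow> (\<Sum>x\<leftarrow>tableau_shape (SD w). min k x) = word_des k w"
    using config_des_well_spaced[OF P0(1) P(1)] des P0(2) by metis
  show "sorted_wrt (\<ge>) (tableau_shape (SD w))"
    using t0(1) unfolding steady_state_def tableau_shape_def SD
    by (simp add: runs_from_right_place_runs[OF Q(1)] flip: Q(2))
  show "0 \<notin> set (tableau_shape (SD w))"
    unfolding tableau_shape_def SD using arrangement_mem[OF Q(1)] by fastforce
qed

theorem theorem7p1:
  fixes n :: nat and \<pi> w :: "nat list"
  assumes "\<pi> \<in> permutations_of_set {1..n}"
    and "w \<in> permutations_of_set {1..n}"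
    and "knuth_equivalent \<pi> w"
  shows "((\<exists>ps. move_sequence knuth_move ps \<pi> w \<and> odd (count_KB_moves ps)) \<longrightarrow> SD \<pi> \<noteq> SD w) \<and>
         ((\<exists>ps. move_sequence non_KB_move ps \<pi> w) \<longrightarrow> tableau_shape (SD \<pi>) = tableau_shape (SD w))"
proof (intro conjI impI; elim exE conjE)
  have \<pi>: "distinct \<pi>" using assms(1) by (rule permutations_of_setD)
  fix ps
  {
    assume "move_sequence knuth_move ps \<pi> w" "odd (count_KB_moves ps)"
    \<comment> \<open>The number of rows equals \<open>D\<^sub>1\<close>, so an odd number of
      \<open>K\<^sub>B\<close> moves changes its parity.\<close>
    then have "length (SD \<pi>) \<noteq> length (SD w)"
      using move_sequence_parity[OF _ \<pi>, of ps w] SD_properties(1)[OF assms(1)] SD_properties(1)[OF assms(2)]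
      by auto
    then show "SD \<pi> \<noteq> SD w" by auto
  next
    assume "move_sequence non_KB_move ps \<pi> w"
    then have "word_des k \<pi> = word_des k w" if "k > 0" for k
      using move_sequence_word_des \<pi> that by blast
    then show "tableau_shape (SD \<pi>) = tableau_shape (SD w)"
      using SD_properties[OF assms(1)] SD_properties[OF assms(2)] by (intro sorted_eq_if_min_sums_eq) auto
  }
qed

end
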